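(* Let $A$ be a non-zero Banach algebra with an involution $\theta$. Under each of the following conditions, $A^{**}$ (with the first Arens product $\Box$) admits a trivolution. (i) There exists a non-zero topologically introverted, faithful subspace $X\subset A^*$ such that the two Arens products coincide on $X^*$, $\theta^*(X)\subset X$, and $A^{**}=X^\circ\oplus X^*$. (ii) $A$ is a dual Banach algebra. (iii) $A$ has a bounded two-sided approximate identity and is a right ideal in $(A^{**},\Box)$. (iv) $A^{**}=I\oplus A$ as a topological direct sum of closed subspaces $I$ and $A$, with $I$ an ideal in $A^{**}$, and the projection $p$ of $A^{**}$ onto $A$ being a homomorphism.
   Context: An involution is a conjugate-linear anti-homomorphism whose square is the identity. A trivolution on a complex algebra is a non-zero conjugate-linear anti-homomorphism $\tau$ (so $\tau(xy)=\tau(y)\tau(x)$) with $\tau^3=\tau\circ\tau\circ\tau=\tau$; on a normed algebra it is additionally assumed that $\|\tau\|=1$ (and since every involution is a trivolution, this normalization applies to $\theta$, which is thus isometric). $\theta^*$ is the conjugate-linear adjoint, $\langle\theta^*(f),a\rangle=\overline{\langle f,\theta(a)\rangle}$ for $f\in A^*$, $a\in A$. For $\lambda\in A^*$ and $a,b\in A$, put $\langle\lambda\cdot a,b\rangle=\langle\lambda,ab\rangle$ and $\langle a\cdot\lambda,b\rangle=\langle\lambda,ba\rangle$. Let $X\subset A^*$ be a norm closed $A$-submodule (under both actions). For $\Psi\in X^*$, $\lambda\in X$ define $\Psi\cdot\lambda,\ \lambda\cdot\Psi\in A^*$ by $\langle\Psi\cdot\lambda,a\rangle=\langle\Psi,\lambda\cdot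 a\rangle$, $\langle\lambda\cdot\Psi,a\rangle=\langle\Psi,a\cdot\lambda\rangle$. $X$ is topologically introverted if $\Psi\cdot\lambda\in X$ and $\lambda\cdot\Psi\in X$ for all $\Psi\in X^*$, $\lambda\in X$. The first and second Arens products on $X^*$ are $\langle\Phi\Box\Psi,\lambda\rangle=\langle\Phi,\Psi\cdot\lambda\rangle$ and $\langle\Phi\Diamond\Psi,\lambda\rangle=\langle\Psi,\lambda\cdot\Phi\rangle$; the case $X=A^*$ gives the Arens products on $A^{**}$. $X$ is faithful if $a\in A$ and $\lambda(a)=0$ for all $\lambda\in X$ imply $a=0$. $X^\circ=\{\Phi\in A^{**}\colon\Phi|_X=0\}$, and $X^*$ is identified with $A^{**}/X^\circ$. In (i), $A^{**}=X^\circ\oplus X^*$ means that $A^{**}$ is the direct sum of $X^\circ$ and a closed subalgebra of $A^{**}$ which is identified with $X^*$ as a Banach algebra through the restriction map $A^{**}\to X^*$, $\Phi\mapsto\Phi|_X$. A dual Banach algebra is a Banach algebra $A$ that is the dual of a Banach space $A_*$ such that multiplication is separately $w^*$-continuous (equivalently, $A_*$, viewed in $A^*$, is an $A$-submodule of $A^*$). $A$ is regarded as a subalgebra of $A^{**}$ canonically; that $A$ is a right ideal in $A^{**}$ means $a\Box\Phi\in A$ for all $a\in A$, $\Phi\in A^{**}$.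
   Formalization: In (iii) and (iv) the trivolution has norm one for an equivalent algebra norm N on A** with ‖·‖ ≤ N ≤ C‖·‖ (C the bound of the approximate identity, resp. ‖p‖), not for the given norm, where the claim can fail if C > 1; (i) and (ii) read the identifications as isometric. *)

theory Defs
  imports "HOL-Analysis.Analysis"
begin

section \<open>Complex normed spaces and algebras\<close>

class scaleC =
  fixes scaleC :: "complex \<Rightarrow> 'a \<Rightarrow> 'a" (infixr \<open>*\<^sub>C\<close> 75)

class complex_normed_space = real_normed_vector + scaleC +
  assumes scaleC_add_right: "c *\<^sub>C (x + y) = c *\<^sub>C x + c *\<^sub>C y"
    and scaleC_add_left: "(c + d) *\<^sub>C x = c *\<^sub>C x + d *\<^sub>C x"
    and scaleC_scaleC: "c *\<^sub>C d *\<^sub>C x = (c * d) *\<^sub>C x"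
    and scaleC_of_real: "of_real r *\<^sub>C x = r *\<^sub>R x"
    and norm_scaleC: "norm (c *\<^sub>C x) = cmod c * norm x"

class complex_banach = complex_normed_space + complete_space
begin
subclass banach ..
end

text \<open>No unit is assumed.\<close>

class complex_banach_algebra = complex_banach + real_normed_algebra +
  assumes mult_scaleC_left: "(c *\<^sub>C x) * y = c *\<^sub>C (x * y)"
    and mult_scaleC_right: "x * (c *\<^sub>C y) = c *\<^sub>C (x * y)"

definition complex_subspace :: "'a::complex_normed_space set \<Rightarrow> bool" where
  "complex_subspace S \<longleftrightarrow>
     0 \<in> S \<and> (\<forall>x\<in>S. \<forall>y\<in>S. x + y \<in> S) \<and> (\<forall>c. \<forall>x\<in>S. c *\<^sub>C x \<in> S)"

definition direct_sum :: "'a::complex_normed_space set \<Rightarrow> 'a set \<Rightarrow> bool" where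
  "direct_sum S T \<longleftrightarrow> S \<inter> T = {0} \<and> (\<forall>x. \<exists>s\<in>S. \<exists>t\<in>T. x = s + t)"


section \<open>The dual space\<close>

text \<open>Bounded complex-linear functionals, with the operator norm of the library's bounded
  real-linear maps.\<close>

typedef (overloaded) 'a cdual =
    "{f :: 'a::complex_normed_space \<Rightarrow>\<^sub>L complex. \<forall>c x. blinfun_apply f (c *\<^sub>C x) = c * blinfun_apply f x}"
  by (rule exI[of _ 0]) simp

setup_lifting type_definition_cdual

definition cdual_apply :: "'a::complex_normed_space cdual \<Rightarrow> 'a \<Rightarrow> complex" (infixl \<open>\<bullet>\<^sub>d\<close> 80) where
  "f \<bullet>\<^sub>d x = blinfun_apply (Rep_cdual f) x"

definition bounded_clinear_form :: "('a::complex_normed_space \<Rightarrow> complex) \<Rightarrow> bool" where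
  "bounded_clinear_form f \<longleftrightarrow> bounded_linear f \<and> (\<forall>c x. f (c *\<^sub>C x) = c * f x)"

definition cdual_of :: "('a::complex_normed_space \<Rightarrow> complex) \<Rightarrow> 'a cdual" where
  "cdual_of f = Abs_cdual (Blinfun f)"

lemma cdual_of_apply: "bounded_clinear_form f \<Longrightarrow> cdual_of f \<bullet>\<^sub>d x = f x"
  by (simp add: cdual_of_def cdual_apply_def bounded_clinear_form_def Abs_cdual_inverse
      bounded_linear_Blinfun_apply)

lemma cdual_eqI: "(\<And>x. f \<bullet>\<^sub>d x = g \<bullet>\<^sub>d x) \<Longrightarrow> f = g"
  by (metis Rep_cdual_inject blinfun_eqI cdual_apply_def)

instantiation cdual :: (complex_normed_space) complex_normed_space
begin

lift_definition zero_cdual :: "'a cdual" is 0 by simp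
lift_definition plus_cdual :: "'a cdual \<Rightarrow> 'a cdual \<Rightarrow> 'a cdual" is "(+)"
  by (simp add: blinfun.add_left algebra_simps)
lift_definition minus_cdual :: "'a cdual \<Rightarrow> 'a cdual \<Rightarrow> 'a cdual" is "(-)"
  by (simp add: blinfun.diff_left algebra_simps)
lift_definition uminus_cdual :: "'a cdual \<Rightarrow> 'a cdual" is uminus
  by (simp add: blinfun.minus_left)
lift_definition scaleR_cdual :: "real \<Rightarrow> 'a cdual \<Rightarrow> 'a cdual" is scaleR
  by (simp add: blinfun.scaleR_left)
lift_definition scaleC_cdual :: "complex \<Rightarrow> 'a cdual \<Rightarrow> 'a cdual" is
  "\<lambda>c f. blinfun_compose (blinfun_mult_right c) f"
  by (simp add: algebra_simps)
lift_definition norm_cdual :: "'a cdual \<Rightarrow> real" is norm .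

definition dist_cdual :: "'a cdual \<Rightarrow> 'a cdual \<Rightarrow> real" where
  "dist_cdual f g = norm (f - g)"
definition sgn_cdual :: "'a cdual \<Rightarrow> 'a cdual" where
  "sgn_cdual f = inverse (norm f) *\<^sub>R f"
definition uniformity_cdual :: "('a cdual \<times> 'a cdual) filter" where
  "uniformity_cdual = (INF e\<in>{0 <..}. principal {(f, g). dist f g < e})"
definition open_cdual :: "'a cdual set \<Rightarrow> bool" where
  "open_cdual S = (\<forall>f\<in>S. \<forall>\<^sub>F (f', g) in uniformity. f' = f \<longrightarrow> g \<in> S)"

instance
proof
  fix f g h :: "'a cdual" and r s :: real and c d :: complex and S :: "'a cdual set"
  show "f + g + h = f + (g + h)" by transfer simp
  show "f + g = g + f" by transfer simp
  show "0 + f = f" by transfer simp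
  show "- f + f = 0" by transfer simp
  show "f - g = f + - g" by transfer simp
  show "r *\<^sub>R (f + g) = r *\<^sub>R f + r *\<^sub>R g" by transfer (simp add: scaleR_add_right)
  show "(r + s) *\<^sub>R f = r *\<^sub>R f + s *\<^sub>R f" by transfer (simp add: scaleR_add_left)
  show "r *\<^sub>R s *\<^sub>R f = (r * s) *\<^sub>R f" by transfer simp
  show "1 *\<^sub>R f = f" by transfer simp
  show "dist f g = norm (f - g)" by (rule dist_cdual_def)
  show "sgn f = inverse (norm f) *\<^sub>R f" by (rule sgn_cdual_def)
  show "uniformity = (INF e\<in>{0 <..}. principal {(f, g). dist f g < (e::real)} :: ('a cdual \<times> 'a cdual) filter)"
    by (rule uniformity_cdual_def)
  show "open S = (\<forall>f\<in>S. \<forall>\<^sub>F (f', g) in uniformity. f' = f \<longrightarrow> g \<in> S)"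
    by (rule open_cdual_def)
  show "(norm f = 0) = (f = 0)" by transfer simp
  show "norm (f + g) \<le> norm f + norm g" by transfer (rule norm_triangle_ineq)
  show "norm (r *\<^sub>R f) = \<bar>r\<bar> * norm f" by transfer simp
  show "c *\<^sub>C (f + g) = c *\<^sub>C f + c *\<^sub>C g"
    by transfer (auto intro!: blinfun_eqI simp: blinfun.add_left algebra_simps)
  show "(c + d) *\<^sub>C f = c *\<^sub>C f + d *\<^sub>C f"
    by transfer (auto intro!: blinfun_eqI simp: blinfun.add_left algebra_simps)
  show "c *\<^sub>C d *\<^sub>C f = (c * d) *\<^sub>C f"
    by transfer (auto intro!: blinfun_eqI)
  show "of_real r *\<^sub>C f = r *\<^sub>R f"
    by transfer (auto intro!: blinfun_eqI simp: blinfun.scaleR_left scaleR_conv_of_real)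
  show "norm (c *\<^sub>C f) = cmod c * norm f"
  proof transfer
    fix c :: complex and f :: "'a \<Rightarrow>\<^sub>L complex"
    let ?g = "blinfun_compose (blinfun_mult_right c) f"
    have le: "norm ?g \<le> cmod c * norm f"
      by (rule norm_blinfun_bound)
        (auto simp: norm_mult mult.assoc intro!: mult_left_mono norm_blinfun)
    show "norm ?g = cmod c * norm f"
    proof (cases "c = 0")
      case True then show ?thesis using le by simp
    next
      case False
      have "norm f \<le> norm ?g / cmod c"
      proof (rule norm_blinfun_bound)
        fix x
        show "norm (blinfun_apply f x) \<le> norm ?g / cmod c * norm x"
          using norm_blinfun[of ?g x] False by (simp add: norm_mult field_simps)
      qed simp
      with False le show ?thesis by (simp add: field_simps)
    qed
  qed
qed

end

lemma cdual_apply_simps [simp]: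
  "(f + g) \<bullet>\<^sub>d x = f \<bullet>\<^sub>d x + g \<bullet>\<^sub>d x" "(f - g) \<bullet>\<^sub>d x = f \<bullet>\<^sub>d x - g \<bullet>\<^sub>d x"
  "(- f) \<bullet>\<^sub>d x = - (f \<bullet>\<^sub>d x)" "0 \<bullet>\<^sub>d x = 0" "(c *\<^sub>C f) \<bullet>\<^sub>d x = c * (f \<bullet>\<^sub>d x)"
  "f \<bullet>\<^sub>d (x + y) = f \<bullet>\<^sub>d x + f \<bullet>\<^sub>d y" "f \<bullet>\<^sub>d (c *\<^sub>C x) = c * (f \<bullet>\<^sub>d x)"
  using Rep_cdual[of f]
  by (simp_all add: cdual_apply_def plus_cdual.rep_eq minus_cdual.rep_eq uminus_cdual.rep_eq
      zero_cdual.rep_eq scaleC_cdual.rep_eq blinfun.add_left blinfun.diff_left blinfun.minus_left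
      blinfun.add_right)

lemma norm_cdual_apply: "cmod (f \<bullet>\<^sub>d x) \<le> norm f * norm x"
  by (simp add: cdual_apply_def norm_cdual.rep_eq norm_blinfun)

lemma bounded_clinear_formI:
  assumes "\<And>x y. f (x + y) = f x + f y" "\<And>c x. f (c *\<^sub>C x) = c * f x"
    and "\<And>x. cmod (f x) \<le> K * norm x"
  shows "bounded_clinear_form f"
proof -
  have "f (r *\<^sub>R x) = r *\<^sub>R f x" for r x
    by (metis assms(2) scaleC_of_real scaleR_conv_of_real)
  then have "bounded_linear f"
    using assms by (intro bounded_linear_intro[where K = K]) (auto simp: mult.commute)
  with assms(2) show ?thesis by (simp add: bounded_clinear_form_def)
qed

instance cdual :: (complex_normed_space) complex_banach
proof
  fix F :: "nat \<Rightarrow> 'a cdual"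
  assume "Cauchy F"
  have *: "dist f g = dist (Rep_cdual f) (Rep_cdual g)" for f g :: "'a cdual"
    by (simp add: dist_cdual_def dist_norm norm_cdual.rep_eq minus_cdual.rep_eq)
  with \<open>Cauchy F\<close> have "Cauchy (\<lambda>n. Rep_cdual (F n))"
    by (simp add: Cauchy_def)
  then obtain L where L: "(\<lambda>n. Rep_cdual (F n)) \<longlonglongrightarrow> L"
    by (meson Cauchy_convergent convergent_def)
  have "blinfun_apply L (c *\<^sub>C x) = c * blinfun_apply L x" for c x
  proof (rule LIMSEQ_unique)
    show "(\<lambda>n. blinfun_apply (Rep_cdual (F n)) (c *\<^sub>C x)) \<longlonglongrightarrow> blinfun_apply L (c *\<^sub>C x)"
      by (intro tendsto_intros L)
    have "(\<lambda>n. c * blinfun_apply (Rep_cdual (F n)) x) \<longlonglongrightarrow> c * blinfun_apply L x"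
      by (intro tendsto_intros L)
    then show "(\<lambda>n. blinfun_apply (Rep_cdual (F n)) (c *\<^sub>C x)) \<longlonglongrightarrow> c * blinfun_apply L x"
      using Rep_cdual[of "F n" for n] by simp
  qed
  then have "Rep_cdual (Abs_cdual L) = L" by (simp add: Abs_cdual_inverse)
  with L have "F \<longlonglongrightarrow> Abs_cdual L"
    by (simp add: tendsto_dist_iff[of F] tendsto_dist_iff[of "\<lambda>n. Rep_cdual (F n)"] *)
  then show "convergent F" by (auto simp: convergent_def)
qed

definition weak_star :: "'a::complex_normed_space cdual topology" where
  "weak_star = pullback_topology UNIV cdual_apply (product_topology (\<lambda>_. euclidean) UNIV)"

definition bidual_embed :: "'a::complex_normed_space \<Rightarrow> 'a cdual cdual" where
  "bidual_embed a = cdual_of (\<lambda>f. f \<bullet>\<^sub>d a)"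

lemma bidual_embed_apply [simp]: "bidual_embed a \<bullet>\<^sub>d f = f \<bullet>\<^sub>d a"
  unfolding bidual_embed_def
  by (intro cdual_of_apply bounded_clinear_formI[where K = "norm a"])
    (auto simp: mult.commute[of "norm a"] norm_cdual_apply)


section \<open>The dual of a subspace\<close>

text \<open>Functionals on the subspace \<open>X\<close> are represented by functions that are
  \<^const>\<open>undefined\<close> outside \<open>X\<close>, so that equality is equality on \<open>X\<close>.\<close>

definition dual_on :: "'b::complex_normed_space set \<Rightarrow> ('b \<Rightarrow> complex) set" where
  "dual_on X = {\<Phi> \<in> extensional X.
     (\<forall>x\<in>X. \<forall>y\<in>X. \<Phi> (x + y) = \<Phi> x + \<Phi> y) \<and> (\<forall>c. \<forall>x\<in>X. \<Phi> (c *\<^sub>C x) = c * \<Phi> x) \<and>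
     (\<exists>K. \<forall>x\<in>X. cmod (\<Phi> x) \<le> K * norm x)}"

definition dual_norm_on :: "'b::complex_normed_space set \<Rightarrow> ('b \<Rightarrow> complex) \<Rightarrow> real" where
  "dual_norm_on X \<Phi> = (SUP x\<in>{x \<in> X. norm x \<le> 1}. cmod (\<Phi> x))"

definition restrict_to :: "'b::complex_normed_space set \<Rightarrow> 'b cdual \<Rightarrow> ('b \<Rightarrow> complex)" where
  "restrict_to X \<Phi> = restrict (cdual_apply \<Phi>) X"

definition annihilator :: "'b::complex_normed_space set \<Rightarrow> 'b cdual set" where
  "annihilator X = {\<Phi>. \<forall>x\<in>X. \<Phi> \<bullet>\<^sub>d x = 0}"


section \<open>Module actions and Arens products\<close>

definition dual_act :: "'a::complex_banach_algebra cdual \<Rightarrow> 'a \<Rightarrow> 'a cdual" (infixl \<open>\<lhd>\<close> 75) where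
  "\<phi> \<lhd> a = cdual_of (\<lambda>b. \<phi> \<bullet>\<^sub>d (a * b))"

definition act_dual :: "'a::complex_banach_algebra \<Rightarrow> 'a cdual \<Rightarrow> 'a cdual" (infixr \<open>\<rhd>\<close> 75) where
  "a \<rhd> \<phi> = cdual_of (\<lambda>b. \<phi> \<bullet>\<^sub>d (b * a))"

definition functional_act ::
    "('a::complex_banach_algebra cdual \<Rightarrow> complex) \<Rightarrow> 'a cdual \<Rightarrow> 'a cdual" where
  "functional_act \<Psi> \<phi> = cdual_of (\<lambda>a. \<Psi> (\<phi> \<lhd> a))"

definition act_functional ::
    "'a::complex_banach_algebra cdual \<Rightarrow> ('a cdual \<Rightarrow> complex) \<Rightarrow> 'a cdual" where
  "act_functional \<phi> \<Psi> = cdual_of (\<lambda>a. \<Psi> (a \<rhd> \<phi>))"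

definition closed_submodule :: "'a::complex_banach_algebra cdual set \<Rightarrow> bool" where
  "closed_submodule X \<longleftrightarrow> complex_subspace X \<and> closed X \<and>
     (\<forall>\<phi>\<in>X. \<forall>a. \<phi> \<lhd> a \<in> X \<and> a \<rhd> \<phi> \<in> X)"

definition introverted :: "'a::complex_banach_algebra cdual set \<Rightarrow> bool" where
  "introverted X \<longleftrightarrow> closed_submodule X \<and>
     (\<forall>\<Psi>\<in>dual_on X. \<forall>\<phi>\<in>X. functional_act \<Psi> \<phi> \<in> X \<and> act_functional \<phi> \<Psi> \<in> X)"

definition faithful :: "'a::complex_banach_algebra cdual set \<Rightarrow> bool" where
  "faithful X \<longleftrightarrow> (\<forall>a. (\<forall>\<phi>\<in>X. \<phi> \<bullet>\<^sub>d a = 0) \<longrightarrow> a = 0)"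

definition arens1_on :: "'a::complex_banach_algebra cdual set \<Rightarrow>
    ('a cdual \<Rightarrow> complex) \<Rightarrow> ('a cdual \<Rightarrow> complex) \<Rightarrow> ('a cdual \<Rightarrow> complex)" where
  "arens1_on X \<Phi> \<Psi> = restrict (\<lambda>\<phi>. \<Phi> (functional_act \<Psi> \<phi>)) X"

definition arens2_on :: "'a::complex_banach_algebra cdual set \<Rightarrow>
    ('a cdual \<Rightarrow> complex) \<Rightarrow> ('a cdual \<Rightarrow> complex) \<Rightarrow> ('a cdual \<Rightarrow> complex)" where
  "arens2_on X \<Phi> \<Psi> = restrict (\<lambda>\<phi>. \<Psi> (act_functional \<phi> \<Phi>)) X"

definition arens1 :: "'a::complex_banach_algebra cdual cdual \<Rightarrow> 'a cdual cdual \<Rightarrow> 'a cdual cdual"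
    (infixl \<open>\<box>\<close> 70) where
  "\<Phi> \<box> \<Psi> = cdual_of (\<lambda>\<phi>. \<Phi> \<bullet>\<^sub>d functional_act (cdual_apply \<Psi>) \<phi>)"

text \<open>\<^const>\<open>cdual_of\<close> is meaningful only on bounded complex-linear forms; the following facts
  record that this is the case wherever it has been used.\<close>

lemma norm_cdual_le:
  assumes "\<And>x. cmod (f \<bullet>\<^sub>d x) \<le> K * norm x" "0 \<le> K"
  shows "norm f \<le> K"
  using assms by (simp add: cdual_apply_def norm_cdual.rep_eq norm_blinfun_bound)

lemma cmod_mult_apply: "cmod (f \<bullet>\<^sub>d (a * b)) \<le> norm f * norm a * norm b"
  for a :: "'a::complex_banach_algebra"
  using order_trans[OF norm_cdual_apply[of f "a * b"] mult_left_mono[OF norm_mult_ineq]]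
  by (simp add: mult.assoc)

lemma dual_act_apply [simp]: "(f \<lhd> a) \<bullet>\<^sub>d b = f \<bullet>\<^sub>d (a * b)"
  unfolding dual_act_def
  by (intro cdual_of_apply bounded_clinear_formI[where K = "norm f * norm a"])
    (auto simp: distrib_left mult_scaleC_right cmod_mult_apply)

lemma act_dual_apply [simp]: "(a \<rhd> f) \<bullet>\<^sub>d b = f \<bullet>\<^sub>d (b * a)"
  unfolding act_dual_def
proof (intro cdual_of_apply bounded_clinear_formI[where K = "norm f * norm a"])
  show "cmod (f \<bullet>\<^sub>d (x * a)) \<le> norm f * norm a * norm x" for x
    using cmod_mult_apply[of f x a] by (simp add: mult.assoc mult.commute[of "norm a"])
qed (auto simp: distrib_right mult_scaleC_left)

lemma norm_dual_act: "norm (f \<lhd> a) \<le> norm f * norm a"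
  by (rule norm_cdual_le) (auto simp: cmod_mult_apply)

lemma norm_act_dual: "norm (a \<rhd> f) \<le> norm f * norm a"
proof (rule norm_cdual_le)
  show "cmod ((a \<rhd> f) \<bullet>\<^sub>d x) \<le> norm f * norm a * norm x" for x
    using cmod_mult_apply[of f x a] by (simp add: mult.assoc mult.commute[of "norm a"])
qed simp

lemma functional_act_apply:
  assumes "closed_submodule X" "\<Psi> \<in> dual_on X" "f \<in> X"
  shows "functional_act \<Psi> f \<bullet>\<^sub>d a = \<Psi> (f \<lhd> a)"
proof -
  obtain K where K: "\<And>x. x \<in> X \<Longrightarrow> cmod (\<Psi> x) \<le> K * norm x"
    using assms(2) by (simp add: dual_on_def) blast
  have K': "cmod (\<Psi> x) \<le> \<bar>K\<bar> * norm x" if "x \<in> X" for x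
    by (rule order_trans[OF K[OF that]]) (simp add: mult_right_mono)
  have in_X: "f \<lhd> a \<in> X" for a
    using assms(1,3) by (simp add: closed_submodule_def)
  have "cmod (\<Psi> (f \<lhd> a)) \<le> \<bar>K\<bar> * norm f * norm a" for a
    using order_trans[OF K'[OF in_X[of a]] mult_left_mono[OF norm_dual_act[of f a]]]
    by (simp add: mult.assoc)
  moreover have "f \<lhd> (a + b) = (f \<lhd> a) + (f \<lhd> b)" "f \<lhd> (c *\<^sub>C a) = c *\<^sub>C (f \<lhd> a)" for a b c
    by (auto intro!: cdual_eqI simp: distrib_right mult_scaleC_left)
  ultimately show ?thesis
    unfolding functional_act_def using assms(2) in_X
    by (intro cdual_of_apply bounded_clinear_formI) (auto simp: dual_on_def)
qed

lemma act_functional_apply: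
  assumes "closed_submodule X" "\<Psi> \<in> dual_on X" "f \<in> X"
  shows "act_functional f \<Psi> \<bullet>\<^sub>d a = \<Psi> (a \<rhd> f)"
proof -
  obtain K where K: "\<And>x. x \<in> X \<Longrightarrow> cmod (\<Psi> x) \<le> K * norm x"
    using assms(2) by (simp add: dual_on_def) blast
  have K': "cmod (\<Psi> x) \<le> \<bar>K\<bar> * norm x" if "x \<in> X" for x
    by (rule order_trans[OF K[OF that]]) (simp add: mult_right_mono)
  have in_X: "a \<rhd> f \<in> X" for a
    using assms(1,3) by (simp add: closed_submodule_def)
  have "cmod (\<Psi> (a \<rhd> f)) \<le> \<bar>K\<bar> * norm f * norm a" for a
    using order_trans[OF K'[OF in_X[of a]] mult_left_mono[OF norm_act_dual[of a f]]]
    by (simp add: mult.assoc)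
  moreover have "(a + b) \<rhd> f = (a \<rhd> f) + (b \<rhd> f)" "(c *\<^sub>C a) \<rhd> f = c *\<^sub>C (a \<rhd> f)" for a b c
    by (auto intro!: cdual_eqI simp: distrib_left mult_scaleC_right)
  ultimately show ?thesis
    unfolding act_functional_def using assms(2) in_X
    by (intro cdual_of_apply bounded_clinear_formI) (auto simp: dual_on_def)
qed

lemma cdual_apply_in_dual_on: "cdual_apply \<Psi> \<in> dual_on UNIV"
  by (auto simp: dual_on_def intro!: exI[of _ "norm \<Psi>"] norm_cdual_apply)

lemma closed_submodule_UNIV: "closed_submodule UNIV"
  by (simp add: closed_submodule_def complex_subspace_def)

lemmas functional_act_bidual_apply [simp] =
  functional_act_apply[OF closed_submodule_UNIV cdual_apply_in_dual_on UNIV_I]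

lemma norm_functional_act: "norm (functional_act (cdual_apply \<Psi>) f) \<le> norm \<Psi> * norm f"
proof (rule norm_cdual_le)
  show "cmod (functional_act (cdual_apply \<Psi>) f \<bullet>\<^sub>d x) \<le> norm \<Psi> * norm f * norm x" for x
    using order_trans[OF norm_cdual_apply[of \<Psi> "f \<lhd> x"] mult_left_mono[OF norm_dual_act[of f x]]]
    by (simp add: mult.assoc)
qed simp

lemma arens1_apply: "(\<Phi> \<box> \<Psi>) \<bullet>\<^sub>d f = \<Phi> \<bullet>\<^sub>d functional_act (cdual_apply \<Psi>) f"
proof -
  have "(f + g) \<lhd> a = (f \<lhd> a) + (g \<lhd> a)" "(c *\<^sub>C f) \<lhd> a = c *\<^sub>C (f \<lhd> a)"
    for f g :: "'a cdual" and a c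
    by (auto intro!: cdual_eqI)
  then have "functional_act (cdual_apply \<Psi>) (f + g) =
      functional_act (cdual_apply \<Psi>) f + functional_act (cdual_apply \<Psi>) g"
    "functional_act (cdual_apply \<Psi>) (c *\<^sub>C f) = c *\<^sub>C functional_act (cdual_apply \<Psi>) f" for f g c
    by (auto intro!: cdual_eqI)
  moreover have "cmod (\<Phi> \<bullet>\<^sub>d functional_act (cdual_apply \<Psi>) f) \<le> norm \<Phi> * norm \<Psi> * norm f" for f
    using order_trans[OF norm_cdual_apply mult_left_mono[OF norm_functional_act]]
    by (simp add: mult.assoc)
  ultimately show ?thesis
    unfolding arens1_def
    by (intro cdual_of_apply bounded_clinear_formI) auto
qed

lemma arens1_eq_arens1_on:
  "cdual_apply (\<Phi> \<box> \<Psi>) = arens1_on UNIV (cdual_apply \<Phi>) (cdual_apply \<Psi>)"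
  by (auto simp: arens1_on_def arens1_apply)


section \<open>Involutions and trivolutions\<close>

text \<open>The multiplication is an argument, because \<open>A\<^sup>*\<^sup>*\<close> carries no preferred one, and so is the
  norm \<open>N\<close> (see \<open>equivalent_algebra_norm\<close> below).\<close>

definition conj_linear :: "('a::complex_normed_space \<Rightarrow> 'a) \<Rightarrow> bool" where
  "conj_linear f \<longleftrightarrow> (\<forall>x y. f (x + y) = f x + f y) \<and> (\<forall>c x. f (c *\<^sub>C x) = cnj c *\<^sub>C f x)"

definition antimultiplicative :: "('a \<Rightarrow> 'a \<Rightarrow> 'a) \<Rightarrow> ('a \<Rightarrow> 'a) \<Rightarrow> bool" where
  "antimultiplicative mul f \<longleftrightarrow> (\<forall>x y. f (mul x y) = mul (f y) (f x))"

definition norm_one :: "('a \<Rightarrow> real) \<Rightarrow> ('a \<Rightarrow> 'a) \<Rightarrow> bool" where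
  "norm_one N f \<longleftrightarrow> (\<exists>K. \<forall>x. N (f x) \<le> K * N x) \<and> (SUP x. N (f x) / N x) = 1"

definition involution ::
    "('a::complex_normed_space \<Rightarrow> real) \<Rightarrow> ('a \<Rightarrow> 'a \<Rightarrow> 'a) \<Rightarrow> ('a \<Rightarrow> 'a) \<Rightarrow> bool" where
  "involution N mul \<theta> \<longleftrightarrow>
     conj_linear \<theta> \<and> antimultiplicative mul \<theta> \<and> \<theta> \<circ> \<theta> = id \<and> norm_one N \<theta>"

definition trivolution ::
    "('a::complex_normed_space \<Rightarrow> real) \<Rightarrow> ('a \<Rightarrow> 'a \<Rightarrow> 'a) \<Rightarrow> ('a \<Rightarrow> 'a) \<Rightarrow> bool" where
  "trivolution N mul \<tau> \<longleftrightarrow> \<tau> \<noteq> (\<lambda>x. 0) \<and>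
     conj_linear \<tau> \<and> antimultiplicative mul \<tau> \<and> \<tau> \<circ> \<tau> \<circ> \<tau> = \<tau> \<and> norm_one N \<tau>"

text \<open>A complex algebra norm between \<open>norm\<close> and \<open>C\<close> times \<open>norm\<close>. For \<open>C = 1\<close> this is
  \<open>norm\<close> itself, and a trivolution for such an \<open>N\<close> has operator norm at most \<open>C\<close> with
  respect to \<open>norm\<close>. Such a change of norm is unavoidable when the approximate identity or the
  projection of \<open>A\<^sup>*\<^sup>*\<close> onto \<open>A\<close> is not bounded by 1: norm one can then fail for every candidate.\<close>

definition equivalent_algebra_norm ::
    "real \<Rightarrow> ('a::complex_normed_space \<Rightarrow> 'a \<Rightarrow> 'a) \<Rightarrow> ('a \<Rightarrow> real) \<Rightarrow> bool" where
  "equivalent_algebra_norm C mul N \<longleftrightarrow>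
     (\<forall>x y. N (x + y) \<le> N x + N y) \<and> (\<forall>c x. N (c *\<^sub>C x) = cmod c * N x) \<and>
     (\<forall>x y. N (mul x y) \<le> N x * N y) \<and> (\<forall>x. norm x \<le> N x \<and> N x \<le> C * norm x)"

lemma equivalent_algebra_norm_1: "equivalent_algebra_norm 1 mul N \<Longrightarrow> N = norm"
  by (auto simp: equivalent_algebra_norm_def intro!: ext antisym)

text \<open>The conjugate-linear adjoint \<open>\<theta>\<^sup>*\<close>.\<close>

definition conj_adjoint :: "('a::complex_normed_space \<Rightarrow> 'a) \<Rightarrow> 'a cdual \<Rightarrow> 'a cdual" where
  "conj_adjoint \<theta> f = cdual_of (\<lambda>a. cnj (f \<bullet>\<^sub>d \<theta> a))"

lemma conj_adjoint_apply:
  assumes "conj_linear \<theta>" "norm_one norm \<theta>"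
  shows "conj_adjoint \<theta> f \<bullet>\<^sub>d a = cnj (f \<bullet>\<^sub>d \<theta> a)"
proof -
  obtain K where K: "\<And>x. norm (\<theta> x) \<le> K * norm x"
    using assms(2) by (auto simp: norm_one_def)
  have "cmod (f \<bullet>\<^sub>d \<theta> x) \<le> norm f * K * norm x" for x
    using order_trans[OF norm_cdual_apply[of f "\<theta> x"] mult_left_mono[OF K]]
    by (simp add: mult.assoc)
  then show ?thesis
    unfolding conj_adjoint_def using assms(1)
    by (intro cdual_of_apply bounded_clinear_formI) (auto simp: conj_linear_def)
qed


section \<open>The conditions on the algebra\<close>

text \<open>\<open>A\<^sup>*\<^sup>* = X\<degree> \<oplus> Y\<close>, where restriction to \<open>X\<close> identifies the closed subalgebra \<open>Y\<close> with the
  Banach algebra \<open>X\<^sup>*\<close>.\<close>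

definition bidual_splits ::
    "'a::complex_banach_algebra cdual set \<Rightarrow> 'a cdual cdual set \<Rightarrow> bool" where
  "bidual_splits X Y \<longleftrightarrow>
     complex_subspace Y \<and> closed Y \<and> (\<forall>\<Phi>\<in>Y. \<forall>\<Psi>\<in>Y. \<Phi> \<box> \<Psi> \<in> Y) \<and>
     direct_sum (annihilator X) Y \<and>
     bij_betw (restrict_to X) Y (dual_on X) \<and>
     (\<forall>\<Phi>\<in>Y. dual_norm_on X (restrict_to X \<Phi>) = norm \<Phi>) \<and>
     (\<forall>\<Phi>\<in>Y. \<forall>\<Psi>\<in>Y. restrict_to X (\<Phi> \<box> \<Psi>) = arens1_on X (restrict_to X \<Phi>) (restrict_to X \<Psi>))"

text \<open>\<open>J\<close> exhibits the Banach space underlying the algebra as the dual of the Banach space \<open>'e\<close>;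
  the weak* topology of the algebra is pulled back along \<open>J\<close>.\<close>

definition dual_banach_algebra ::
    "('a::complex_banach_algebra \<Rightarrow> 'e::complex_banach cdual) \<Rightarrow> bool" where
  "dual_banach_algebra J \<longleftrightarrow>
     bij J \<and> (\<forall>x y. J (x + y) = J x + J y) \<and> (\<forall>c x. J (c *\<^sub>C x) = c *\<^sub>C J x) \<and>
     (\<forall>x. norm (J x) = norm x) \<and>
     (let T = pullback_topology UNIV J weak_star in
        \<forall>a. continuous_map T T (\<lambda>x. a * x) \<and> continuous_map T T (\<lambda>x. x * a))"

text \<open>A net in the algebra is represented by its filter of tails.\<close>

definition bounded_approximate_identity :: "real \<Rightarrow> 'a::complex_banach_algebra filter \<Rightarrow> bool" where
  "bounded_approximate_identity C F \<longleftrightarrow>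
     F \<noteq> bot \<and> (\<forall>\<^sub>F e in F. norm e \<le> C) \<and>
     (\<forall>a. ((\<lambda>e. e * a) \<longlongrightarrow> a) F \<and> ((\<lambda>e. a * e) \<longlongrightarrow> a) F)"

definition right_ideal_in_bidual :: "'a::complex_banach_algebra itself \<Rightarrow> bool" where
  "right_ideal_in_bidual _ \<longleftrightarrow>
     (\<forall>(a::'a) \<Phi>. bidual_embed a \<box> \<Phi> \<in> range bidual_embed)"

text \<open>\<open>p\<close> is the projection onto \<open>A\<close> along \<open>I\<close>; its boundedness expresses that the direct sum is
  topological.\<close>

definition bidual_splits_over_ideal :: "'a::complex_banach_algebra cdual cdual set \<Rightarrow>
    ('a cdual cdual \<Rightarrow> 'a cdual cdual) \<Rightarrow> bool" where
  "bidual_splits_over_ideal I p \<longleftrightarrow>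
     complex_subspace I \<and> closed I \<and> closed (range (bidual_embed :: 'a \<Rightarrow> _)) \<and>
     direct_sum I (range bidual_embed) \<and>
     (\<forall>\<Phi>\<in>I. \<forall>\<Psi>. \<Phi> \<box> \<Psi> \<in> I \<and> \<Psi> \<box> \<Phi> \<in> I) \<and>
     bounded_linear p \<and> (\<forall>\<Phi>\<in>I. \<forall>a. p (\<Phi> + bidual_embed a) = bidual_embed a) \<and>
     (\<forall>\<Phi> \<Psi>. p (\<Phi> \<box> \<Psi>) = p \<Phi> \<box> p \<Psi>)"

end

theory Submission
  imports Defs
begin

text \<open>
  All four trivolutions come from the second adjoint \<open>\<theta>\<^sup>*\<^sup>*\<close> of the involution. It is an isometric
  conjugate-linear map of period two on \<open>A\<^sup>*\<^sup>*\<close> that extends \<open>\<theta>\<close>, but it turns the first Arens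
  product into the reversed second one, so in general it is not an involution of \<open>A\<^sup>*\<^sup>*\<close>. The remedy
  is a bounded linear idempotent \<open>p\<close> that preserves \<open>\<box>\<close> and whose range is a part of the bidual on
  which \<open>\<theta>\<^sup>*\<^sup>*\<close> induces an involution. Then \<open>\<tau> = p \<circ> \<theta>\<^sup>*\<^sup>* \<circ> p\<close> satisfies
  \<open>\<tau> \<circ> \<tau> = p\<close> and \<open>\<tau> \<circ> \<tau> \<circ> \<tau> = \<tau>\<close>. In each case one of the two factors \<open>p\<close> may be omitted, so
  that \<open>\<tau>\<close> is bounded by the norm of \<open>p\<close> and not only by its square.

  \<^item> If \<open>A\<^sup>*\<^sup>* = X\<degree> \<oplus> Y\<close> with \<open>Y\<close> a copy of \<open>X\<^sup>*\<close>, then \<open>p\<close> is the projection onto \<open>Y\<close>; on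
    \<open>X\<close> the Arens products agree (\<open>trivolution_if_introverted_split\<close>).
  \<^item> If \<open>A\<close> is a dual Banach algebra, then \<open>p\<close> restricts functionals to the predual, and if
    \<open>A\<^sup>*\<^sup>* = I \<oplus> A\<close>, then \<open>p\<close> is the given projection. In both cases the range is \<open>A\<close>, where
    \<open>\<theta>\<^sup>*\<^sup>*\<close> is \<open>\<theta>\<close> (\<open>trivolution_of_projection_onto_algebra\<close>). The predual is a submodule of
    \<open>A\<^sup>*\<close> because weak* continuous functionals are evaluations (\<open>predual_submodule\<close>).
  \<^item> If \<open>A\<close> has a bounded approximate identity and is a right ideal, a weak* cluster point \<open>E\<close> of
    the approximate identity is a right unit of the bidual, and \<open>p \<Phi> = E \<box> \<Phi>\<close>. The involution
    makes \<open>A\<close> a two-sided ideal, so the range of \<open>p\<close> consists of double multipliers of \<open>A\<close>, which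
    inherit an involution (\<open>trivolution_if_right_ideal\<close>).

  Norm one is arranged in \<open>trivolution_up_to_equivalent_norm\<close> by a maximum of three norms. That \<open>\<tau>\<close>
  is not zero requires a non-zero functional on \<open>A\<close> whenever \<open>p\<close> is the identity on \<open>A\<close>; it is
  supplied by a weak form of the Hahn--Banach theorem (\<open>separating_functional\<close>).
\<close>

section \<open>A bounded functional that does not vanish at a given vector\<close>

definition sublinear :: "('a::real_vector \<Rightarrow> real) \<Rightarrow> bool" where
  "sublinear p \<longleftrightarrow> p 0 = 0 \<and> (\<forall>x y. p (x + y) \<le> p x + p y) \<and> (\<forall>t>0. \<forall>x. p (t *\<^sub>R x) \<le> t * p x)"

lemma sublinear_scaleR:
  assumes "sublinear p" "0 \<le> t"
  shows "p (t *\<^sub>R x) = t * p x"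
proof (cases "t = 0")
  case False
  with assms(2) have t: "0 < t" by simp
  have "p (inverse t *\<^sub>R t *\<^sub>R x) \<le> inverse t * p (t *\<^sub>R x)"
    using assms(1) t unfolding sublinear_def by (metis positive_imp_inverse_positive)
  then have "t * p x \<le> p (t *\<^sub>R x)"
    using t by (simp add: field_simps)
  moreover have "p (t *\<^sub>R x) \<le> t * p x"
    using assms(1) t unfolding sublinear_def by blast
  ultimately show ?thesis by simp
qed (use assms in \<open>simp add: sublinear_def\<close>)

lemma sublinear_minus_le:
  assumes "sublinear p"
  shows "- p (- x) \<le> p x"
proof -
  have "p (x + - x) \<le> p x + p (- x)" "p 0 = 0"
    using assms unfolding sublinear_def by blast+
  then show ?thesis by simp
qed

text \<open>The largest sublinear functional \<open>q \<le> p\<close> with \<open>q (x + t a) = q x + t p(a)\<close> for all \<open>x\<close> and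
  \<open>t \<ge> 0\<close>. It forces minimal sublinear functionals to be linear.\<close>

definition straighten :: "('a::real_vector \<Rightarrow> real) \<Rightarrow> 'a \<Rightarrow> 'a \<Rightarrow> real" where
  "straighten p a x = (INF t\<in>{0..}. p (x + t *\<^sub>R a) - t * p a)"

lemma straighten_le:
  assumes "sublinear p" "0 \<le> t"
  shows "straighten p a x \<le> p (x + t *\<^sub>R a) - t * p a"
proof -
  have "- p (- x) \<le> p (x + s *\<^sub>R a) - s * p a" if "0 \<le> s" for s
  proof -
    have "p (s *\<^sub>R a) = s * p a" "p (x + s *\<^sub>R a + - x) \<le> p (x + s *\<^sub>R a) + p (- x)"
      using assms(1) sublinear_scaleR[OF assms(1) that] unfolding sublinear_def by blast+
    then show ?thesis by simp
  qed
  then have "bdd_below ((\<lambda>t. p (x + t *\<^sub>R a) - t * p a) ` {0..})"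
    by (auto intro!: bdd_belowI2[where m = "- p (- x)"])
  then show ?thesis
    unfolding straighten_def using assms(2) by (intro cINF_lower) auto
qed

lemma straighten_greatest:
  "(\<And>t. 0 \<le> t \<Longrightarrow> c \<le> p (x + t *\<^sub>R a) - t * p a) \<Longrightarrow> c \<le> straighten p a x"
  unfolding straighten_def by (intro cINF_greatest) auto

lemma sublinear_straighten:
  assumes p: "sublinear p"
  shows "sublinear (straighten p a)"
  unfolding sublinear_def
proof (intro conjI allI impI)
  show "straighten p a 0 = 0"
    unfolding straighten_def using sublinear_scaleR[OF p] by simp
next
  fix x y
  have *: "straighten p a (x + y) \<le> (p (x + s *\<^sub>R a) - s * p a) + (p (y + t *\<^sub>R a) - t * p a)"
    if "0 \<le> s" "0 \<le> t" for s t
  proof -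
    have "p ((x + s *\<^sub>R a) + (y + t *\<^sub>R a)) \<le> p (x + s *\<^sub>R a) + p (y + t *\<^sub>R a)"
      using p unfolding sublinear_def by blast
    moreover have "(x + s *\<^sub>R a) + (y + t *\<^sub>R a) = x + y + (s + t) *\<^sub>R a"
      by (simp add: scaleR_add_left)
    ultimately show ?thesis
      using straighten_le[OF p, of "s + t" a "x + y"] that by (simp add: algebra_simps)
  qed
  have "straighten p a (x + y) - straighten p a y \<le> straighten p a x"
  proof (rule straighten_greatest)
    fix s :: real assume s: "0 \<le> s"
    have "straighten p a (x + y) - (p (x + s *\<^sub>R a) - s * p a) \<le> straighten p a y"
      by (rule straighten_greatest) (use *[OF s] in \<open>simp add: algebra_simps\<close>)
    then show "straighten p a (x + y) - straighten p a y \<le> p (x + s *\<^sub>R a) - s * p a"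
      by simp
  qed
  then show "straighten p a (x + y) \<le> straighten p a x + straighten p a y"
    by simp
next
  fix t :: real and x assume t: "0 < t"
  have "straighten p a (t *\<^sub>R x) / t \<le> straighten p a x"
  proof (rule straighten_greatest)
    fix s :: real assume s: "0 \<le> s"
    have "straighten p a (t *\<^sub>R x) \<le> p (t *\<^sub>R x + (t * s) *\<^sub>R a) - t * s * p a"
      using straighten_le[OF p, of "t * s"] s t by simp
    also have "p (t *\<^sub>R x + (t * s) *\<^sub>R a) = t * p (x + s *\<^sub>R a)"
      using sublinear_scaleR[OF p, of t "x + s *\<^sub>R a"] t by (simp add: scaleR_add_right)
    finally show "straighten p a (t *\<^sub>R x) / t \<le> p (x + s *\<^sub>R a) - s * p a"
      using t by (simp add: field_simps)
  qed
  then show "straighten p a (t *\<^sub>R x) \<le> t * straighten p a x"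
    using t by (simp add: field_simps)
qed

lemma straighten_below: "sublinear p \<Longrightarrow> straighten p a \<le> p"
  using straighten_le[of p 0 a] by (auto simp: le_fun_def)

text \<open>The infimum of a chain of sublinear functionals is again sublinear: of two members the smaller
  one bounds the infimum at \<open>x + y\<close>. Zorn's lemma then applies.\<close>

lemma minimal_sublinear_below:
  assumes q: "sublinear q"
  obtains p where "sublinear p" "p \<le> q" "\<And>r. sublinear r \<Longrightarrow> r \<le> p \<Longrightarrow> r = p"
proof -
  define S where "S = {p. sublinear p \<and> p \<le> q}"
  let ?P = "\<lambda>f g :: 'a \<Rightarrow> real. g \<le> f"
  have "\<exists>m\<in>S. \<forall>r\<in>S. ?P m r \<longrightarrow> r = m"
  proof (rule predicate_Zorn)
    show "partial_order_on S (relation_of ?P S)"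
      by (auto simp: partial_order_on_def preorder_on_def refl_on_def trans_def antisym_def
          relation_of_def intro: order_trans)
  next
    fix C assume C: "C \<in> Chains (relation_of ?P S)"
    show "\<exists>u\<in>S. \<forall>r\<in>C. u \<le> r"
    proof (cases "C = {}")
      case True
      then show ?thesis using q by (auto simp: S_def)
    next
      case False
      have sub: "sublinear r" "r \<le> q" if "r \<in> C" for r
        using C that by (auto simp: Chains_def relation_of_def S_def)
      have total: "r \<le> s \<or> s \<le> r" if "r \<in> C" "s \<in> C" for r s
        using C that by (auto simp: Chains_def relation_of_def)
      define u where "u = (\<lambda>x. INF r\<in>C. r x)"
      have bdd: "bdd_below ((\<lambda>r. r x) ` C)" for x
      proof (rule bdd_belowI2)
        fix r assume "r \<in> C"
        then show "- q (- x) \<le> r x"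
          using sublinear_minus_le[OF sub(1), of r x] sub(2)[of r] le_funD[of r q "- x"] by simp
      qed
      have lower: "u x \<le> r x" if "r \<in> C" for r x
        unfolding u_def using bdd that by (rule cINF_lower)
      have greatest: "c \<le> u x" if "\<And>r. r \<in> C \<Longrightarrow> c \<le> r x" for c x
        unfolding u_def using False that by (rule cINF_greatest)
      have "sublinear u"
        unfolding sublinear_def
      proof (intro conjI allI impI)
        show "u 0 = 0"
        proof -
          have "(\<lambda>r. r 0) ` C = (\<lambda>r. 0) ` C"
            by (rule image_cong) (use sub(1) in \<open>auto simp: sublinear_def\<close>)
          then show ?thesis using False by (simp add: u_def)
        qed
      next
        fix x y
        have *: "u (x + y) \<le> r x + s y" if rs: "r \<in> C" "s \<in> C" for r s
        proof -
          from total[OF rs] obtain w where w: "w \<in> C" "w \<le> r" "w \<le> s"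
            using rs by blast
          have "u (x + y) \<le> w (x + y)" using lower[OF w(1)] .
          also have "\<dots> \<le> w x + w y" using sub(1)[OF w(1)] unfolding sublinear_def by blast
          also have "\<dots> \<le> r x + s y" using le_funD[OF w(2), of x] le_funD[OF w(3), of y] by simp
          finally show ?thesis .
        qed
        have "u (x + y) - u y \<le> u x"
        proof (rule greatest)
          fix r assume r: "r \<in> C"
          have "u (x + y) - r x \<le> u y"
            by (rule greatest) (use *[OF r] in \<open>simp add: algebra_simps\<close>)
          then show "u (x + y) - u y \<le> r x" by simp
        qed
        then show "u (x + y) \<le> u x + u y" by simp
      next
        fix t :: real and x assume t: "0 < t"
        have "u (t *\<^sub>R x) / t \<le> u x"
        proof (rule greatest)
          fix r assume r: "r \<in> C"
          have "u (t *\<^sub>R x) \<le> r (t *\<^sub>R x)" using lower[OF r] .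
          also have "\<dots> = t * r x" using sublinear_scaleR[OF sub(1)[OF r]] t by simp
          finally show "u (t *\<^sub>R x) / t \<le> r x" using t by (simp add: field_simps)
        qed
        then show "u (t *\<^sub>R x) \<le> t * u x" using t by (simp add: field_simps)
      qed
      moreover obtain r where "r \<in> C" using False by blast
      ultimately have "u \<in> S"
        using lower[of r] sub(2)[of r] by (auto simp: S_def le_fun_def intro: order_trans)
      then show ?thesis using lower by (auto simp: le_fun_def)
    qed
  qed
  then obtain m where m: "m \<in> S" "\<And>r. r \<in> S \<Longrightarrow> r \<le> m \<Longrightarrow> r = m" by blast
  show thesis
    by (rule that[of m]) (use m in \<open>auto simp: S_def intro: order_trans\<close>)
qed

text \<open>A minimal sublinear functional equals all its straightenings, so it is additive in every
  direction.\<close>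

lemma minimal_sublinear_additive:
  assumes p: "sublinear p" and min: "\<And>r. sublinear r \<Longrightarrow> r \<le> p \<Longrightarrow> r = p"
  shows "p (x + y) = p x + p y"
proof -
  have "p x = straighten p y x"
    using min[OF sublinear_straighten[OF p] straighten_below[OF p]] by metis
  also have "\<dots> \<le> p (x + y) - p y"
    using straighten_le[OF p, of 1 y x] by simp
  finally show ?thesis
    using p unfolding sublinear_def by (smt (verit))
qed

text \<open>The Hahn--Banach theorem in the weak form needed here. Below the norm straightened along \<open>a\<close>
  every functional is at most \<open>- norm a\<close> at \<open>- a\<close>, so a minimal one does not vanish at \<open>a\<close>.\<close>

lemma separating_functional:
  fixes a :: "'a::complex_normed_space"
  assumes "a \<noteq> 0"
  obtains f :: "'a cdual" where "f \<bullet>\<^sub>d a \<noteq> 0"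
proof -
  have norm: "sublinear (norm :: 'a \<Rightarrow> real)"
    by (auto simp: sublinear_def norm_triangle_ineq)
  obtain p :: "'a \<Rightarrow> real" where p: "sublinear p" "p \<le> straighten norm a"
    "\<And>r. sublinear r \<Longrightarrow> r \<le> p \<Longrightarrow> r = p"
    using minimal_sublinear_below[OF sublinear_straighten[OF norm]] by metis
  have add: "p (x + y) = p x + p y" for x y
    using minimal_sublinear_additive[OF p(1,3)] .
  have minus: "p (- x) = - p x" for x
    using add[of x "- x"] p(1) by (simp add: sublinear_def)
  have scale: "p (r *\<^sub>R x) = r * p x" for r x
  proof (cases "0 \<le> r")
    case False
    then have "p (r *\<^sub>R x) = - p ((- r) *\<^sub>R x)" by (simp add: minus)
    then show ?thesis using False sublinear_scaleR[OF p(1), of "- r" x] by simp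
  qed (rule sublinear_scaleR[OF p(1)])
  have le: "p x \<le> norm x" for x
    using p(2) straighten_below[OF norm, of a] by (meson le_funD order_trans)
  then have bound: "\<bar>p x\<bar> \<le> norm x" for x
    using le[of "- x"] le[of x] by (auto simp: minus abs_if)
  have "p (- a) \<le> straighten norm a (- a)"
    using p(2) by (rule le_funD)
  also have "\<dots> \<le> - norm a"
    using straighten_le[OF norm, of 1 a "- a"] by simp
  finally have "p a \<noteq> 0" using assms by (auto simp: minus)
  \<comment> \<open>A real linear functional is the real part of a unique complex linear one.\<close>
  define g where "g x = Complex (p x) (- p (\<i> *\<^sub>C x))" for x :: 'a
  have decomp: "c *\<^sub>C x = Re c *\<^sub>R x + Im c *\<^sub>R (\<i> *\<^sub>C x)" for c and x :: 'a
  proof -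
    have "c *\<^sub>C x = (of_real (Re c) + of_real (Im c) * \<i>) *\<^sub>C x"
      by (metis complex_eq mult.commute)
    then show ?thesis
      by (simp only: scaleC_add_left scaleC_of_real flip: scaleC_scaleC)
  qed
  have ii: "\<i> *\<^sub>C \<i> *\<^sub>C x = - x" for x :: 'a
    using decomp[of "-1" x] by (simp add: scaleC_scaleC)
  have form: "bounded_clinear_form g"
  proof (rule bounded_clinear_formI[where K = 2])
    show "g (x + y) = g x + g y" for x y
      by (simp add: g_def scaleC_add_right add complex_eq_iff)
  next
    fix c and x :: 'a
    have "\<i> *\<^sub>C c *\<^sub>C x = c *\<^sub>C \<i> *\<^sub>C x"
      by (simp add: scaleC_scaleC mult.commute)
    also have "\<dots> = Re c *\<^sub>R (\<i> *\<^sub>C x) + Im c *\<^sub>R (- x)"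
      using decomp[of c "\<i> *\<^sub>C x"] ii[of x] by simp
    finally have "\<i> *\<^sub>C c *\<^sub>C x = Re c *\<^sub>R (\<i> *\<^sub>C x) + Im c *\<^sub>R (- x)" .
    then have "p (\<i> *\<^sub>C c *\<^sub>C x) = Re c * p (\<i> *\<^sub>C x) - Im c * p x"
      by (simp only: add scale minus)
    moreover have "p (c *\<^sub>C x) = Re c * p x + Im c * p (\<i> *\<^sub>C x)"
      by (simp only: decomp[of c x] add scale)
    ultimately show "g (c *\<^sub>C x) = c * g x"
      by (simp add: g_def complex_eq_iff)
  next
    fix x :: 'a
    have "cmod (g x) \<le> \<bar>p x\<bar> + \<bar>p (\<i> *\<^sub>C x)\<bar>"
      using cmod_le[of "g x"] by (simp add: g_def)
    also have "\<dots> \<le> norm x + norm (\<i> *\<^sub>C x)"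
      by (intro add_mono bound)
    finally show "cmod (g x) \<le> 2 * norm x" by (simp add: norm_scaleC)
  qed
  show thesis
    by (rule that[of "cdual_of g"])
      (use \<open>p a \<noteq> 0\<close> in \<open>simp add: cdual_of_apply[OF form] g_def complex_eq_iff\<close>)
qed

section \<open>Calculus of the first Arens product\<close>

lemma norm_bidual_embed_le: "norm (bidual_embed a) \<le> norm a"
  by (rule norm_cdual_le) (auto simp: norm_cdual_apply mult.commute[of "norm a"])

lemma bidual_embed_add: "bidual_embed (a + b) = bidual_embed a + bidual_embed b"
  and bidual_embed_scaleC: "bidual_embed (c *\<^sub>C a) = c *\<^sub>C bidual_embed a"
  by (auto intro!: cdual_eqI)

lemma bidual_embed_nonzero:
  assumes "a \<noteq> 0"
  shows "bidual_embed a \<noteq> 0"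
proof
  assume zero: "bidual_embed a = 0"
  obtain f where "f \<bullet>\<^sub>d a \<noteq> 0" using separating_functional[OF assms] .
  then show False using zero bidual_embed_apply[of a f] by simp
qed

text \<open>When one factor lies in the algebra, the product is the adjoint of a module action and has no
  iterated limit.\<close>

lemma bidual_embed_arens1_apply: "(bidual_embed a \<box> \<Phi>) \<bullet>\<^sub>d f = \<Phi> \<bullet>\<^sub>d (f \<lhd> a)"
  by (simp add: arens1_apply)

lemma functional_act_bidual_embed: "functional_act (cdual_apply (bidual_embed a)) f = a \<rhd> f"
  by (auto intro!: cdual_eqI)

lemma arens1_bidual_embed_apply: "(\<Phi> \<box> bidual_embed a) \<bullet>\<^sub>d f = \<Phi> \<bullet>\<^sub>d (a \<rhd> f)"
  by (simp add: arens1_apply functional_act_bidual_embed)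

lemma bidual_embed_mult: "bidual_embed (a * b) = bidual_embed a \<box> bidual_embed b"
  by (auto intro!: cdual_eqI simp: bidual_embed_arens1_apply)

lemma arens1_linear_right:
  "\<Phi> \<box> (\<Psi> + \<Psi>') = \<Phi> \<box> \<Psi> + \<Phi> \<box> \<Psi>'" "\<Phi> \<box> (\<Psi> - \<Psi>') = \<Phi> \<box> \<Psi> - \<Phi> \<box> \<Psi>'"
  "\<Phi> \<box> (c *\<^sub>C \<Psi>) = c *\<^sub>C (\<Phi> \<box> \<Psi>)"
proof -
  have act: "functional_act (cdual_apply (\<Psi> + \<Psi>')) f =
      functional_act (cdual_apply \<Psi>) f + functional_act (cdual_apply \<Psi>') f"
    "functional_act (cdual_apply (c *\<^sub>C \<Psi>)) f = c *\<^sub>C functional_act (cdual_apply \<Psi>) f"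
    for \<Psi> \<Psi>' c and f :: "'a cdual"
    by (auto intro!: cdual_eqI)
  show add: "\<Phi> \<box> (\<Psi> + \<Psi>') = \<Phi> \<box> \<Psi> + \<Phi> \<box> \<Psi>'" for \<Psi> \<Psi>'
    by (auto intro!: cdual_eqI simp: arens1_apply act)
  show "\<Phi> \<box> (\<Psi> - \<Psi>') = \<Phi> \<box> \<Psi> - \<Phi> \<box> \<Psi>'"
    using add[of "\<Psi> - \<Psi>'" \<Psi>'] by (simp add: algebra_simps)
  show "\<Phi> \<box> (c *\<^sub>C \<Psi>) = c *\<^sub>C (\<Phi> \<box> \<Psi>)"
    by (auto intro!: cdual_eqI simp: arens1_apply act)
qed

lemma arens1_assoc: "(\<Phi> \<box> \<Psi>) \<box> \<Xi> = \<Phi> \<box> (\<Psi> \<box> \<Xi>)"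
proof -
  have act: "functional_act (cdual_apply \<Xi>) (f \<lhd> a) = functional_act (cdual_apply \<Xi>) f \<lhd> a"
    for f :: "'a cdual" and a
    by (auto intro!: cdual_eqI) (auto intro!: arg_cong[where f = "cdual_apply \<Xi>"] cdual_eqI simp: mult.assoc)
  have "functional_act (cdual_apply (\<Psi> \<box> \<Xi>)) f =
      functional_act (cdual_apply \<Psi>) (functional_act (cdual_apply \<Xi>) f)" for f
    by (auto intro!: cdual_eqI simp: arens1_apply act)
  then show ?thesis
    by (auto intro!: cdual_eqI simp: arens1_apply)
qed

lemma norm_arens1: "norm (\<Phi> \<box> \<Psi>) \<le> norm \<Phi> * norm \<Psi>"
proof (rule norm_cdual_le)
  show "cmod ((\<Phi> \<box> \<Psi>) \<bullet>\<^sub>d f) \<le> norm \<Phi> * norm \<Psi> * norm f" for f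
    using order_trans[OF norm_cdual_apply mult_left_mono[OF norm_functional_act]]
    by (simp add: arens1_apply mult.assoc)
qed simp


section \<open>Trivolutions of norm one for an equivalent norm\<close>

text \<open>The new norm is the maximum of the norms of \<open>x\<close>, \<open>\<tau> x\<close> and \<open>\<tau> (\<tau> x)\<close>. It is
  submultiplicative because \<open>\<tau>\<close> reverses products and \<open>\<tau> \<circ> \<tau>\<close> preserves them, and \<open>\<tau>\<close> does not
  increase it because \<open>\<tau>\<close> merely exchanges \<open>\<tau> x\<close> and \<open>\<tau> (\<tau> x)\<close>. Since \<open>\<tau> \<circ> \<tau>\<close> is the identity
  on the non-zero range of \<open>\<tau>\<close>, the bounds force \<open>C \<ge> 1\<close>; if \<open>C = 1\<close>, the new norm is the old
  one.\<close>

lemma trivolution_up_to_equivalent_norm: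
  fixes \<tau> :: "'b::complex_normed_space \<Rightarrow> 'b"
  assumes mul: "\<And>x y. norm (mul x y) \<le> norm x * norm y"
    and nonzero: "\<tau> \<noteq> (\<lambda>x. 0)"
    and conj: "conj_linear \<tau>"
    and anti: "antimultiplicative mul \<tau>"
    and cube: "\<And>x. \<tau> (\<tau> (\<tau> x)) = \<tau> x"
    and bound: "\<And>x. norm (\<tau> x) \<le> C * norm x" "\<And>x. norm (\<tau> (\<tau> x)) \<le> C * norm x"
  shows "\<exists>N. equivalent_algebra_norm C mul N \<and> trivolution N mul \<tau>"
proof -
  define N where "N x = max (norm x) (max (norm (\<tau> x)) (norm (\<tau> (\<tau> x))))" for x
  have add: "\<tau> (x + y) = \<tau> x + \<tau> y" and scale: "\<tau> (c *\<^sub>C x) = cnj c *\<^sub>C \<tau> x" for c x y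
    using conj unfolding conj_linear_def by blast+
  have tmul: "\<tau> (mul x y) = mul (\<tau> y) (\<tau> x)" for x y
    using anti unfolding antimultiplicative_def by blast
  have N_ge: "norm x \<le> N x" "norm (\<tau> x) \<le> N x" "norm (\<tau> (\<tau> x)) \<le> N x" "0 \<le> N x" for x
    by (auto simp: N_def le_max_iff_disj)
  have N_le: "N x \<le> b" if "norm x \<le> b" "norm (\<tau> x) \<le> b" "norm (\<tau> (\<tau> x)) \<le> b" for x b
    using that by (simp add: N_def)
  obtain z where z: "\<tau> z \<noteq> 0" using nonzero by auto
  have "norm (\<tau> z) \<le> C * norm (\<tau> z)"
    using bound(2)[of "\<tau> z"] by (simp add: cube)
  then have C: "1 \<le> C" using z by simp
  have "equivalent_algebra_norm C mul N"
    unfolding equivalent_algebra_norm_def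
  proof (intro conjI allI)
    show "N (x + y) \<le> N x + N y" for x y
      unfolding N_def[of "x + y"] add
      by (intro max.boundedI order_trans[OF norm_triangle_ineq] add_mono N_ge)
    show "N (c *\<^sub>C x) = cmod c * N x" for c x
      by (simp add: N_def scale norm_scaleC max_mult_distrib_left)
    show "N (mul x y) \<le> N x * N y" for x y
    proof (rule N_le)
      show "norm (mul x y) \<le> N x * N y" "norm (\<tau> (\<tau> (mul x y))) \<le> N x * N y"
        unfolding tmul by (intro order_trans[OF mul] mult_mono N_ge; simp)+
      show "norm (\<tau> (mul x y)) \<le> N x * N y"
        unfolding tmul mult.commute[of "N x"] by (intro order_trans[OF mul] mult_mono N_ge; simp)
    qed
    show "norm x \<le> N x" for x by (rule N_ge)
    show "N x \<le> C * norm x" for x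
      using C bound[of x] mult_right_mono[OF C, of "norm x"] by (intro N_le) auto
  qed
  moreover have "norm_one N \<tau>"
    unfolding norm_one_def
  proof
    have le: "N (\<tau> x) \<le> N x" for x
      by (rule N_le) (use N_ge[of x] cube in auto)
    then show "\<exists>K. \<forall>x. N (\<tau> x) \<le> K * N x" by (intro exI[of _ 1]) simp
    have ratio: "N (\<tau> x) / N x \<le> 1" for x
      using le[of x] N_ge(4)[of x] by (auto simp: divide_le_eq_1)
    \<comment> \<open>The supremum is attained at \<open>\<tau> z\<close>, for which the first and the third of the norms that
      define \<open>N\<close> agree and \<open>\<tau>\<close> exchanges them with the second.\<close>
    have "N (\<tau> (\<tau> z)) = N (\<tau> z)"
      by (auto simp: N_def cube)
    moreover have "0 < N (\<tau> z)"
      using N_ge(1)[of "\<tau> z"] z by (meson less_le_trans zero_less_norm_iff)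
    ultimately have "N (\<tau> (\<tau> z)) / N (\<tau> z) = 1" by simp
    then show "(SUP x. N (\<tau> x) / N x) = 1"
      using ratio by (intro cSup_eq_maximum) (auto intro!: rev_image_eqI[of "\<tau> z"])
  qed
  ultimately have "trivolution N mul \<tau>"
    using nonzero conj anti cube by (auto simp: trivolution_def)
  with \<open>equivalent_algebra_norm C mul N\<close> show ?thesis by blast
qed

section \<open>The bidual of an algebra with involution\<close>

text \<open>The form for contractions applies to \<open>\<theta>\<close> and again to \<open>\<theta>\<^sup>*\<close>; that \<open>\<theta>\<^sup>*\<close> has norm one
  presupposes a non-zero functional.\<close>

lemma conj_adjoint_contraction:
  assumes "conj_linear \<theta>" "\<And>x. norm (\<theta> x) \<le> norm x"
  shows "conj_adjoint \<theta> f \<bullet>\<^sub>d a = cnj (f \<bullet>\<^sub>d \<theta> a)"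
    and "conj_linear (conj_adjoint \<theta>)"
    and "norm (conj_adjoint \<theta> f) \<le> norm f"
proof -
  have bound: "cmod (f \<bullet>\<^sub>d \<theta> x) \<le> norm f * norm x" for f x
    using order_trans[OF norm_cdual_apply[of f "\<theta> x"] mult_left_mono[OF assms(2)]] by simp
  then show eval: "conj_adjoint \<theta> f \<bullet>\<^sub>d a = cnj (f \<bullet>\<^sub>d \<theta> a)" for f a
    unfolding conj_adjoint_def using assms(1)
    by (intro cdual_of_apply bounded_clinear_formI) (auto simp: conj_linear_def)
  show "conj_linear (conj_adjoint \<theta>)"
    by (auto simp: conj_linear_def eval intro!: cdual_eqI)
  show "norm (conj_adjoint \<theta> f) \<le> norm f"
    by (rule norm_cdual_le) (simp_all add: eval bound)
qed

locale algebra_with_involution =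
  fixes \<theta> :: "'a::complex_banach_algebra \<Rightarrow> 'a"
  assumes involution: "involution norm (*) \<theta>"
begin

abbreviation adj :: "'a cdual \<Rightarrow> 'a cdual" where "adj \<equiv> conj_adjoint \<theta>"

abbreviation biadj :: "'a cdual cdual \<Rightarrow> 'a cdual cdual" where "biadj \<equiv> conj_adjoint adj"

lemma theta_mult: "\<theta> (a * b) = \<theta> b * \<theta> a"
  using involution by (simp add: involution_def antimultiplicative_def)

lemma theta_theta [simp]: "\<theta> (\<theta> a) = a"
  using involution by (metis involution_def comp_apply id_apply)

lemma conj_linear_theta: "conj_linear \<theta>"
  using involution by (simp add: involution_def)

lemma norm_theta_le: "norm (\<theta> a) \<le> norm a"
proof -
  obtain K where K: "\<And>x. norm (\<theta> x) \<le> K * norm x"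
    and sup: "(SUP x. norm (\<theta> x) / norm x) = 1"
    using involution by (auto simp: involution_def norm_one_def)
  have "norm (\<theta> x) / norm x \<le> \<bar>K\<bar>" for x
    using K[of x] by (cases "x = 0") (auto simp: divide_le_eq intro: order_trans mult_right_mono)
  then have "bdd_above (range (\<lambda>x. norm (\<theta> x) / norm x))"
    by (auto intro!: bdd_aboveI2)
  then have "norm (\<theta> a) / norm a \<le> 1"
    using cSUP_upper[OF UNIV_I, of "\<lambda>x. norm (\<theta> x) / norm x" a] sup by simp
  then show ?thesis
    using K[of 0] by (cases "a = 0") (auto simp: divide_le_eq)
qed

lemmas adj_apply [simp] = conj_adjoint_contraction(1)[OF conj_linear_theta norm_theta_le]
lemmas conj_linear_adj = conj_adjoint_contraction(2)[OF conj_linear_theta norm_theta_le]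
lemmas norm_adj_le = conj_adjoint_contraction(3)[OF conj_linear_theta norm_theta_le]

lemmas biadj_apply [simp] = conj_adjoint_contraction(1)[OF conj_linear_adj norm_adj_le]
lemmas conj_linear_biadj = conj_adjoint_contraction(2)[OF conj_linear_adj norm_adj_le]
lemmas norm_biadj_le = conj_adjoint_contraction(3)[OF conj_linear_adj norm_adj_le]

lemma biadj_add: "biadj (\<Phi> + \<Psi>) = biadj \<Phi> + biadj \<Psi>"
  and biadj_scaleC: "biadj (c *\<^sub>C \<Phi>) = cnj c *\<^sub>C biadj \<Phi>"
  using conj_linear_biadj by (simp_all add: conj_linear_def)

lemma adj_adj [simp]: "adj (adj f) = f"
  by (auto intro!: cdual_eqI)

lemma biadj_biadj [simp]: "biadj (biadj \<Phi>) = \<Phi>"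
  by (auto intro!: cdual_eqI)

lemma biadj_embed [simp]: "biadj (bidual_embed a) = bidual_embed (\<theta> a)"
  by (auto intro!: cdual_eqI)

lemma adj_dual_act: "adj (f \<lhd> a) = \<theta> a \<rhd> adj f"
  and adj_act_dual: "adj (a \<rhd> f) = adj f \<lhd> \<theta> a"
  by (auto intro!: cdual_eqI simp: theta_mult)


section \<open>Multiplicative projections onto the algebra\<close>

text \<open>\<open>\<theta>\<^sup>*\<^sup>*\<close> extends \<open>\<theta>\<close>, so on the range of \<open>p\<close> it is an involution, and \<open>\<theta>\<^sup>*\<^sup>* \<circ> p\<close> is a
  trivolution with square \<open>p\<close>. It reverses all products because \<open>p\<close> first moves both factors
  into the algebra; on the whole bidual \<open>\<theta>\<^sup>*\<^sup>*\<close> turns the first Arens product into the reversed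
  second one.\<close>

lemma trivolution_of_projection_onto_algebra:
  fixes p :: "'a cdual cdual \<Rightarrow> 'a cdual cdual"
  assumes nonzero: "\<exists>a::'a. a \<noteq> 0"
    and add: "\<And>\<Phi> \<Psi>. p (\<Phi> + \<Psi>) = p \<Phi> + p \<Psi>"
    and scale: "\<And>c \<Phi>. p (c *\<^sub>C \<Phi>) = c *\<^sub>C p \<Phi>"
    and range: "\<And>\<Phi>. p \<Phi> \<in> range bidual_embed"
    and embed: "\<And>a. p (bidual_embed a) = bidual_embed a"
    and mult: "\<And>\<Phi> \<Psi>. p (\<Phi> \<box> \<Psi>) = p \<Phi> \<box> p \<Psi>"
    and bound: "\<And>\<Phi>. norm (p \<Phi>) \<le> C * norm \<Phi>"
  shows "\<exists>N (\<tau> :: 'a cdual cdual \<Rightarrow> 'a cdual cdual). equivalent_algebra_norm C (\<box>) N \<and> trivolution N (\<box>) \<tau>"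
proof -
  define \<tau> where "\<tau> \<Phi> = biadj (p \<Phi>)" for \<Phi>
  have \<tau>\<tau>: "\<tau> (\<tau> \<Phi>) = p \<Phi>" for \<Phi>
  proof -
    obtain a where "p \<Phi> = bidual_embed a" using range by blast
    then show ?thesis by (simp add: \<tau>_def embed)
  qed
  have "\<tau> \<noteq> (\<lambda>\<Phi>. 0)"
  proof
    assume zero: "\<tau> = (\<lambda>\<Phi>. 0)"
    obtain a :: 'a where "a \<noteq> 0" using nonzero by blast
    moreover have "bidual_embed a = \<tau> (\<tau> (bidual_embed a))" by (simp add: \<tau>\<tau> embed)
    ultimately show False using zero bidual_embed_nonzero[of a] by simp
  qed
  moreover have "conj_linear \<tau>"
    by (simp add: conj_linear_def \<tau>_def add scale biadj_add biadj_scaleC)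
  moreover have "antimultiplicative (\<box>) \<tau>"
    unfolding antimultiplicative_def
  proof (intro allI)
    fix \<Phi> \<Psi>
    obtain a b where "p \<Phi> = bidual_embed a" "p \<Psi> = bidual_embed b" using range by blast
    then show "\<tau> (\<Phi> \<box> \<Psi>) = \<tau> \<Psi> \<box> \<tau> \<Phi>"
      by (simp add: \<tau>_def mult theta_mult flip: bidual_embed_mult)
  qed
  moreover have "p (p \<Phi>) = p \<Phi>" for \<Phi>
    using range[of \<Phi>] embed by force
  then have "\<tau> (\<tau> (\<tau> \<Phi>)) = \<tau> \<Phi>" for \<Phi>
    unfolding \<tau>\<tau>[of \<Phi>] by (simp add: \<tau>_def)
  moreover have "norm (\<tau> \<Phi>) \<le> C * norm \<Phi>" "norm (\<tau> (\<tau> \<Phi>)) \<le> C * norm \<Phi>" for \<Phi>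
    using order_trans[OF norm_biadj_le bound, of \<Phi>] bound[of \<Phi>] by (simp_all add: \<tau>\<tau>) (simp add: \<tau>_def)
  ultimately show ?thesis
    using trivolution_up_to_equivalent_norm[of "(\<box>)" \<tau> C] norm_arens1 by blast
qed

lemma trivolution_if_bidual_splits_over_ideal:
  fixes I :: "'a cdual cdual set"
  assumes nonzero: "\<exists>a::'a. a \<noteq> 0"
    and split: "bidual_splits_over_ideal I p"
  shows "\<exists>N (\<tau> :: 'a cdual cdual \<Rightarrow> 'a cdual cdual).
    equivalent_algebra_norm (onorm p) (\<box>) N \<and> trivolution N (\<box>) \<tau>"
proof -
  have I: "complex_subspace I" and sum: "direct_sum I (range (bidual_embed :: 'a \<Rightarrow> _))"
    and p: "bounded_linear p" and mult: "\<And>\<Phi> \<Psi>. p (\<Phi> \<box> \<Psi>) = p \<Phi> \<box> p \<Psi>"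
    and eval: "\<And>\<Phi> a. \<Phi> \<in> I \<Longrightarrow> p (\<Phi> + bidual_embed a) = bidual_embed a"
    using split by (auto simp: bidual_splits_over_ideal_def)
  have decomp: "\<exists>\<Xi>\<in>I. \<exists>a. \<Phi> = \<Xi> + bidual_embed a" for \<Phi>
    using sum by (auto simp: direct_sum_def)
  have embed: "p (bidual_embed a) = bidual_embed a" for a
    using eval[of 0 a] I by (simp add: complex_subspace_def)
  have range: "p \<Phi> \<in> range bidual_embed" for \<Phi>
    using decomp[of \<Phi>] eval by auto
  have scale: "p (c *\<^sub>C \<Phi>) = c *\<^sub>C p \<Phi>" for c \<Phi>
  proof -
    obtain \<Xi> a where \<Phi>: "\<Xi> \<in> I" "\<Phi> = \<Xi> + bidual_embed a" using decomp by blast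
    then have "c *\<^sub>C \<Phi> = c *\<^sub>C \<Xi> + bidual_embed (c *\<^sub>C a)"
      by (simp add: scaleC_add_right bidual_embed_scaleC)
    moreover have "c *\<^sub>C \<Xi> \<in> I" using I \<Phi>(1) by (simp add: complex_subspace_def)
    ultimately have "p (c *\<^sub>C \<Phi>) = bidual_embed (c *\<^sub>C a)" using eval by metis
    then show ?thesis using eval \<Phi> by (simp add: bidual_embed_scaleC)
  qed
  show ?thesis
    by (rule trivolution_of_projection_onto_algebra[OF nonzero, where p = p])
      (use linear_add[OF bounded_linear.linear[OF p]] scale range embed mult onorm[OF p] in auto)
qed

end

section \<open>Dual Banach algebras\<close>

text \<open>The algebraic core of the fact that weak* continuous functionals are evaluations, by induction
  on the finite set of evaluations that control \<open>g\<close>.\<close>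

lemma linear_form_is_evaluation:
  fixes g :: "'e::complex_normed_space cdual \<Rightarrow> complex"
  assumes "finite S"
    and "\<And>x y. g (x + y) = g x + g y" "\<And>c x. g (c *\<^sub>C x) = c * g x"
    and "\<And>x. (\<forall>e\<in>S. x \<bullet>\<^sub>d e = 0) \<Longrightarrow> g x = 0"
  shows "\<exists>e. \<forall>x. g x = x \<bullet>\<^sub>d e"
  using assms
proof (induction S arbitrary: g rule: finite_induct)
  case empty
  have "x \<bullet>\<^sub>d 0 = 0" for x :: "'e cdual"
    using norm_cdual_apply[of x 0] by simp
  with empty show ?case by (intro exI[of _ 0]) simp
next
  case (insert s S)
  show ?case
  proof (cases "\<forall>x. (\<forall>e\<in>S. x \<bullet>\<^sub>d e = 0) \<longrightarrow> x \<bullet>\<^sub>d s = 0")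
    case True
    then show ?thesis using insert.IH[of g] insert.prems by simp
  next
    case False
    then obtain y where y: "\<forall>e\<in>S. y \<bullet>\<^sub>d e = 0" "y \<bullet>\<^sub>d s \<noteq> 0" by blast
    define z where "z = inverse (y \<bullet>\<^sub>d s) *\<^sub>C y"
    have z: "\<forall>e\<in>S. z \<bullet>\<^sub>d e = 0" "z \<bullet>\<^sub>d s = 1" using y by (simp_all add: z_def)
    \<comment> \<open>Subtracting a multiple of the evaluation at \<open>s\<close> removes \<open>s\<close> from the hypothesis.\<close>
    define h where "h x = g x - g z * (x \<bullet>\<^sub>d s)" for x
    have "\<exists>e. \<forall>x. h x = x \<bullet>\<^sub>d e"
    proof (rule insert.IH)
      fix x assume "\<forall>e\<in>S. x \<bullet>\<^sub>d e = 0"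
      then have "g (x + (- (x \<bullet>\<^sub>d s)) *\<^sub>C z) = 0"
        using z by (intro insert.prems(3)) auto
      then show "h x = 0"
        unfolding insert.prems(1,2) h_def by (simp add: mult.commute)
    qed (simp_all add: h_def insert.prems(1,2) algebra_simps)
    then obtain e where "\<And>x. h x = x \<bullet>\<^sub>d e" by blast
    then have "\<forall>x. g x = x \<bullet>\<^sub>d (e + g z *\<^sub>C s)"
      by (simp add: h_def) (metis add.commute diff_add_cancel)
    then show ?thesis ..
  qed
qed

text \<open>Basic neighbourhoods in a product constrain only finitely many coordinates.\<close>

lemma weak_star_open_contains_kernel:
  assumes "openin (pullback_topology UNIV J weak_star) U" "x0 \<in> U" "J x0 = 0"
  shows "\<exists>S. finite S \<and> (\<forall>x. (\<forall>e\<in>S. J x \<bullet>\<^sub>d e = 0) \<longrightarrow> x \<in> U)"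
proof -
  obtain V where V: "openin (product_topology (\<lambda>_. euclidean) UNIV) V"
    and U: "U = J -` cdual_apply -` V"
    using assms(1) by (auto simp: openin_pullback_topology weak_star_def)
  have "cdual_apply (0 :: 'b cdual) \<in> V" using assms(2,3) by (simp add: U)
  then obtain W where W: "cdual_apply (0 :: 'b cdual) \<in> Pi\<^sub>E UNIV W"
      "finite {e. W e \<noteq> UNIV}" "Pi\<^sub>E UNIV W \<subseteq> V"
    using product_topology_open_contains_basis[OF V] by (auto 0 0) blast
  have "x \<in> U" if "\<forall>e\<in>{e. W e \<noteq> UNIV}. J x \<bullet>\<^sub>d e = 0" for x
  proof -
    have "J x \<bullet>\<^sub>d e \<in> W e" for e
    proof (cases "W e = UNIV")
      case False
      then have "J x \<bullet>\<^sub>d e = (0 :: 'b cdual) \<bullet>\<^sub>d e" using that by simp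
      also have "\<dots> \<in> W e" using W(1) by (rule PiE_mem) simp
      finally show ?thesis .
    qed simp
    then show ?thesis using W(3) by (auto simp: U)
  qed
  with W(2) show ?thesis by blast
qed

text \<open>The functionals \<open>b \<mapsto> \<langle>J b, e\<rangle>\<close> form the predual inside \<open>A\<^sup>*\<close>. Composing
  such a functional with a multiplication gives a weak* continuous functional, which is bounded on
  a common kernel of finitely many evaluations, hence zero there and again of this form.\<close>

lemma predual_submodule:
  assumes J: "dual_banach_algebra J"
  shows "\<exists>e'. \<forall>b. J (a * b) \<bullet>\<^sub>d e = J b \<bullet>\<^sub>d e'" "\<exists>e'. \<forall>b. J (b * a) \<bullet>\<^sub>d e = J b \<bullet>\<^sub>d e'"
proof -
  define T where "T = pullback_topology UNIV J weak_star"
  have bij: "bij J" and add: "\<And>x y. J (x + y) = J x + J y"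
    and scale: "\<And>c x. J (c *\<^sub>C x) = c *\<^sub>C J x"
    and left: "\<And>a. continuous_map T T (\<lambda>x. a * x)"
    and right: "\<And>a. continuous_map T T (\<lambda>x. x * a)"
    using J by (auto simp: dual_banach_algebra_def Let_def T_def)
  have zero: "J 0 = 0" using add[of 0 0] by simp
  have J_inv: "J (inv J x) = x" and inv_J: "inv J (J b) = b" for x b
    using bij by (simp_all add: bij_is_surj surj_f_inv_f bij_is_inj)
  have *: "\<exists>e'. \<forall>b. J (m b) \<bullet>\<^sub>d e = J b \<bullet>\<^sub>d e'"
    if cont: "continuous_map T T m" and m_add: "\<And>x y. m (x + y) = m x + m y"
      and m_scale: "\<And>c x. m (c *\<^sub>C x) = c *\<^sub>C m x" for m :: "'a \<Rightarrow> 'a"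
  proof -
    define G where "G = {f :: 'b \<Rightarrow> complex. f e \<in> ball 0 1}"
    define U where "U = {x. J (m x) \<bullet>\<^sub>d e \<in> ball 0 1}"
    have "openin (product_topology (\<lambda>_. euclidean) UNIV) G"
      using openin_continuous_map_preimage[OF continuous_map_product_projection[OF UNIV_I,
          where X = "\<lambda>_::'b. euclidean :: complex topology"], of "ball 0 1" e]
      by (simp add: G_def dist_norm)
    moreover have "{x. J x \<bullet>\<^sub>d e \<in> ball 0 1} = J -` cdual_apply -` G"
      by (auto simp: G_def)
    ultimately have "openin T {x. J x \<bullet>\<^sub>d e \<in> ball 0 1}"
      by (auto simp: T_def openin_pullback_topology weak_star_def)
    from openin_continuous_map_preimage[OF cont this] have "openin T U"
      by (simp add: U_def T_def topspace_pullback_topology weak_star_def)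
    moreover have "m 0 = 0" using m_add[of 0 0] by simp
    ultimately obtain S where S: "finite S" "\<And>x. (\<forall>s\<in>S. J x \<bullet>\<^sub>d s = 0) \<Longrightarrow> x \<in> U"
      using weak_star_open_contains_kernel[of J U 0] zero by (auto simp: T_def U_def)
    have "\<exists>e'. \<forall>x. J (m (inv J x)) \<bullet>\<^sub>d e = x \<bullet>\<^sub>d e'"
    proof (rule linear_form_is_evaluation[OF S(1)])
      show "J (m (inv J (x + y))) \<bullet>\<^sub>d e = J (m (inv J x)) \<bullet>\<^sub>d e + J (m (inv J y)) \<bullet>\<^sub>d e" for x y
      proof -
        have "inv J (x + y) = inv J x + inv J y"
          using inv_J[of "inv J x + inv J y"] by (simp add: add J_inv)
        then show ?thesis by (simp add: m_add add)
      qed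
      show "J (m (inv J (c *\<^sub>C x))) \<bullet>\<^sub>d e = c * (J (m (inv J x)) \<bullet>\<^sub>d e)" for c x
      proof -
        have "inv J (c *\<^sub>C x) = c *\<^sub>C inv J x"
          using inv_J[of "c *\<^sub>C inv J x"] by (simp add: scale J_inv)
        then show ?thesis by (simp add: m_scale scale)
      qed
    next
      fix x assume x: "\<forall>s\<in>S. x \<bullet>\<^sub>d s = 0"
      define w where "w = J (m (inv J x)) \<bullet>\<^sub>d e"
      \<comment> \<open>All multiples of \<open>x\<close> lie in the common kernel, so all multiples of the value \<open>w\<close> lie in
        the unit ball.\<close>
      have "cmod (c * w) < 1" for c
      proof -
        have "J (c *\<^sub>C inv J x) \<bullet>\<^sub>d s = 0" if "s \<in> S" for s
          using x that by (simp add: scale J_inv)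
        then have "c *\<^sub>C inv J x \<in> U" using S(2) by blast
        then show ?thesis by (simp add: U_def m_scale scale w_def)
      qed
      from this[of "inverse w"] show "w = 0" by (cases "w = 0") auto
    qed
    then obtain e' where "\<And>x. J (m (inv J x)) \<bullet>\<^sub>d e = x \<bullet>\<^sub>d e'" by blast
    from this[of "J _"] show ?thesis by (auto simp: inv_J)
  qed
  show "\<exists>e'. \<forall>b. J (a * b) \<bullet>\<^sub>d e = J b \<bullet>\<^sub>d e'"
    using left by (rule *) (simp_all add: distrib_left mult_scaleC_right)
  show "\<exists>e'. \<forall>b. J (b * a) \<bullet>\<^sub>d e = J b \<bullet>\<^sub>d e'"
    using right by (rule *) (simp_all add: distrib_right mult_scaleC_left)
qed

context algebra_with_involution
begin

text \<open>The restriction \<open>\<pi>\<close> of functionals on \<open>A\<^sup>*\<close> to the predual is the projection onto \<open>A\<close>. It is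
  multiplicative because for \<open>\<lambda>\<close> in the predual \<open>\<Psi> \<cdot> \<lambda> = \<pi> \<Psi> \<cdot> \<lambda>\<close>, which is in the
  predual again.\<close>

lemma trivolution_if_dual_banach_algebra:
  fixes J :: "'a \<Rightarrow> 'e::complex_banach cdual"
  assumes nonzero: "\<exists>a::'a. a \<noteq> 0"
    and J: "dual_banach_algebra J"
  shows "\<exists>\<tau> :: 'a cdual cdual \<Rightarrow> 'a cdual cdual. trivolution norm (\<box>) \<tau>"
proof -
  have bij: "bij J" and add: "\<And>x y. J (x + y) = J x + J y"
    and scale: "\<And>c x. J (c *\<^sub>C x) = c *\<^sub>C J x" and norm: "\<And>x. norm (J x) = norm x"
    using J by (auto simp: dual_banach_algebra_def)
  have J_inv: "J (inv J x) = x" and inv_J: "inv J (J b) = b" for x b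
    using bij by (simp_all add: bij_is_surj surj_f_inv_f bij_is_inj)
  have J_cong: "a = b" if "\<And>e. J a \<bullet>\<^sub>d e = J b \<bullet>\<^sub>d e" for a b
    using cdual_eqI[of "J a" "J b"] that inv_J by metis
  define \<iota> where "\<iota> e = cdual_of (\<lambda>b. J b \<bullet>\<^sub>d e)" for e
  have \<iota>: "\<iota> e \<bullet>\<^sub>d b = J b \<bullet>\<^sub>d e" for e b
    unfolding \<iota>_def
    by (intro cdual_of_apply bounded_clinear_formI[where K = "norm e"])
      (use norm_cdual_apply[of "J b" e for b] norm in \<open>auto simp: add scale mult.commute[of "norm e"] dest: spec\<close>)
  have \<iota>_add: "\<iota> (e + e') = \<iota> e + \<iota> e'" and \<iota>_scale: "\<iota> (c *\<^sub>C e) = c *\<^sub>C \<iota> e" for e e' c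
    by (auto intro!: cdual_eqI simp: \<iota>)
  have norm_\<iota>: "norm (\<iota> e) \<le> norm e" for e
  proof (rule norm_cdual_le)
    show "cmod (\<iota> e \<bullet>\<^sub>d b) \<le> norm e * norm b" for b
      using norm_cdual_apply[of "J b" e] by (simp add: \<iota> norm mult.commute)
  qed simp
  define \<pi> where "\<pi> \<Phi> = inv J (cdual_of (\<lambda>e. \<Phi> \<bullet>\<^sub>d \<iota> e))" for \<Phi> :: "'a cdual cdual"
  have bound: "cmod (\<Phi> \<bullet>\<^sub>d \<iota> e) \<le> norm \<Phi> * norm e" for \<Phi> :: "'a cdual cdual" and e
    using order_trans[OF norm_cdual_apply mult_left_mono[OF norm_\<iota>]] by simp
  then have \<pi>: "J (\<pi> \<Phi>) \<bullet>\<^sub>d e = \<Phi> \<bullet>\<^sub>d \<iota> e" for \<Phi> e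
    unfolding \<pi>_def J_inv
    by (intro cdual_of_apply bounded_clinear_formI) (auto simp: \<iota>_add \<iota>_scale)
  have norm_\<pi>: "norm (\<pi> \<Phi>) \<le> norm \<Phi>" for \<Phi>
    unfolding norm[symmetric] by (rule norm_cdual_le) (simp_all add: \<pi> bound norm_cdual_le)
  have \<pi>_mult: "\<pi> (\<Phi> \<box> \<Psi>) = \<pi> \<Phi> * \<pi> \<Psi>" for \<Phi> \<Psi>
  proof (rule J_cong)
    fix e
    obtain e' where e': "\<And>b. J (b * \<pi> \<Psi>) \<bullet>\<^sub>d e = J b \<bullet>\<^sub>d e'"
      using predual_submodule(2)[OF J] by blast
    have "functional_act (cdual_apply \<Psi>) (\<iota> e) = \<iota> e'"
    proof (rule cdual_eqI)
      fix a
      obtain e'' where e'': "\<And>b. J (a * b) \<bullet>\<^sub>d e = J b \<bullet>\<^sub>d e''"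
        using predual_submodule(1)[OF J] by blast
      have "\<iota> e \<lhd> a = \<iota> e''" by (auto intro!: cdual_eqI simp: \<iota> e'')
      then show "functional_act (cdual_apply \<Psi>) (\<iota> e) \<bullet>\<^sub>d a = \<iota> e' \<bullet>\<^sub>d a"
        by (simp add: \<iota> flip: \<pi> e' e'')
    qed
    then show "J (\<pi> (\<Phi> \<box> \<Psi>)) \<bullet>\<^sub>d e = J (\<pi> \<Phi> * \<pi> \<Psi>) \<bullet>\<^sub>d e"
      by (simp add: \<pi> arens1_apply e')
  qed
  have \<pi>_add: "\<pi> (\<Phi> + \<Psi>) = \<pi> \<Phi> + \<pi> \<Psi>" and \<pi>_scale: "\<pi> (c *\<^sub>C \<Phi>) = c *\<^sub>C \<pi> \<Phi>" for \<Phi> \<Psi> c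
    by (rule J_cong, simp add: \<pi> add scale)+
  have \<pi>_embed: "\<pi> (bidual_embed a) = a" for a
    by (rule J_cong) (simp add: \<pi> \<iota>)
  have "\<exists>N (\<tau> :: 'a cdual cdual \<Rightarrow> 'a cdual cdual). equivalent_algebra_norm 1 (\<box>) N \<and> trivolution N (\<box>) \<tau>"
    using nonzero
  proof (rule trivolution_of_projection_onto_algebra[where p = "\<lambda>\<Phi>. bidual_embed (\<pi> \<Phi>)"])
    show "norm (bidual_embed (\<pi> \<Phi>)) \<le> 1 * norm \<Phi>" for \<Phi>
      using order_trans[OF norm_bidual_embed_le norm_\<pi>] by simp
  qed (simp_all add: \<pi>_add \<pi>_scale \<pi>_embed \<pi>_mult bidual_embed_add bidual_embed_scaleC bidual_embed_mult)
  then show ?thesis using equivalent_algebra_norm_1 by blast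
qed

end

section \<open>Right ideals in the bidual\<close>

text \<open>The Banach--Alaoglu theorem for the bidual: Tychonoff's theorem provides a cluster point
  of the evaluations, and \<open>G\<close> is a subnet of \<open>F\<close> that converges to it.\<close>

lemma bounded_filter_weak_star_cluster:
  fixes F :: "'a::complex_normed_space filter"
  assumes "F \<noteq> bot" and bdd: "\<forall>\<^sub>F e in F. norm e \<le> C"
  obtains E G where "norm E \<le> C" "G \<le> F" "G \<noteq> bot" "\<And>f. ((\<lambda>e. f \<bullet>\<^sub>d e) \<longlongrightarrow> E \<bullet>\<^sub>d f) G"
proof -
  define ev :: "'a \<Rightarrow> 'a cdual \<Rightarrow> complex" where "ev e f = f \<bullet>\<^sub>d e" for e f
  define K :: "('a cdual \<Rightarrow> complex) set" where "K = Pi\<^sub>E UNIV (\<lambda>f. cball 0 (C * norm f))"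
  have "compactin (product_topology (\<lambda>_. euclidean) UNIV) K"
    unfolding K_def compactin_PiE by simp
  then have "compact K" by (simp add: euclidean_product_topology)
  moreover have "filtermap ev F \<noteq> bot" using assms(1) by (simp add: filtermap_bot_iff)
  moreover have "\<forall>\<^sub>F x in filtermap ev F. x \<in> K"
    unfolding eventually_filtermap using bdd
  proof eventually_elim
    case (elim e)
    have "cmod (f \<bullet>\<^sub>d e) \<le> C * norm f" for f
      using order_trans[OF norm_cdual_apply mult_left_mono[OF elim]] by (simp add: mult.commute)
    then show ?case by (auto simp: K_def ev_def)
  qed
  ultimately obtain g where g: "g \<in> K" and cluster: "inf (nhds g) (filtermap ev F) \<noteq> bot"
    unfolding compact_filter by blast
  define G where "G = inf F (filtercomap ev (nhds g))"
  have "G \<noteq> bot"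
  proof
    assume "G = bot"
    then obtain P Q where P: "eventually P F" and Q: "eventually Q (nhds g)"
      and PQ: "\<And>e. P e \<Longrightarrow> \<not> Q (ev e)"
      unfolding G_def trivial_limit_def eventually_inf eventually_filtercomap by blast
    have "eventually (\<lambda>x. \<not> Q x) (filtermap ev F)"
      unfolding eventually_filtermap using P by eventually_elim (rule PQ)
    then have "eventually (\<lambda>x. False) (inf (nhds g) (filtermap ev F))"
      unfolding eventually_inf using Q by blast
    then show False using cluster by (simp add: trivial_limit_def)
  qed
  have "filterlim ev (nhds g) G"
    unfolding filterlim_def G_def
    by (rule order_trans[OF filtermap_mono[OF inf_le2]]) (rule filtermap_filtercomap)
  from continuous_on_tendsto_compose[OF continuous_on_product_coordinates this]
  have lim: "((\<lambda>e. f \<bullet>\<^sub>d e) \<longlongrightarrow> g f) G" for f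
    by (simp add: ev_def)
  have "g (x + y) = g x + g y" for x y
    using tendsto_unique[OF \<open>G \<noteq> bot\<close> lim[of "x + y"]] tendsto_add[OF lim[of x] lim[of y]] by simp
  moreover have "g (c *\<^sub>C x) = c * g x" for c x
    using tendsto_unique[OF \<open>G \<noteq> bot\<close> lim[of "c *\<^sub>C x"]] tendsto_mult_left[OF lim[of x]] by simp
  moreover have bound: "cmod (g x) \<le> C * norm x" for x
    using PiE_mem[OF g[unfolded K_def] UNIV_I, of x] by simp
  ultimately have E: "cdual_of g \<bullet>\<^sub>d f = g f" for f
    by (intro cdual_of_apply bounded_clinear_formI)
  have "0 \<le> C"
    using eventually_happens[OF bdd] assms(1) norm_ge_zero order_trans by blast
  show thesis
  proof (rule that)
    show "norm (cdual_of g) \<le> C"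
      by (rule norm_cdual_le) (use bound E \<open>0 \<le> C\<close> in auto)
    show "((\<lambda>e. f \<bullet>\<^sub>d e) \<longlongrightarrow> cdual_of g \<bullet>\<^sub>d f) G" for f
      using lim by (simp add: E)
  qed (use \<open>G \<noteq> bot\<close> in \<open>auto simp: G_def\<close>)
qed

lemma tendsto_cdual_apply:
  assumes "(h \<longlongrightarrow> a) G"
  shows "((\<lambda>e. f \<bullet>\<^sub>d h e) \<longlongrightarrow> f \<bullet>\<^sub>d a) G"
  unfolding cdual_apply_def
  using bounded_linear.tendsto[OF blinfun.bounded_linear_right assms] .

text \<open>Cluster points of a bounded approximate identity are mixed units: right units of the bidual
  that are also left units for the algebra. The last property says that the algebra detects
  \<open>E \<box> A\<^sup>*\<^sup>*\<close>.\<close>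

lemma mixed_unit:
  fixes F :: "'a::complex_banach_algebra filter"
  assumes "bounded_approximate_identity C F"
  obtains E :: "'a cdual cdual" where "norm E \<le> C" "\<And>\<Phi>. \<Phi> \<box> E = \<Phi>"
    "\<And>a. E \<box> bidual_embed a = bidual_embed a"
    "\<And>\<Phi>. (\<And>a. bidual_embed a \<box> \<Phi> = 0) \<Longrightarrow> E \<box> \<Phi> = 0"
proof -
  have F: "F \<noteq> bot" "\<forall>\<^sub>F e in F. norm e \<le> C"
    and left: "\<And>a. ((\<lambda>e. e * a) \<longlongrightarrow> a) F" and right: "\<And>a. ((\<lambda>e. a * e) \<longlongrightarrow> a) F"
    using assms by (auto simp: bounded_approximate_identity_def)
  obtain E G where E: "norm E \<le> C" and G: "G \<le> F" "G \<noteq> bot"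
    and lim: "\<And>f. ((\<lambda>e. f \<bullet>\<^sub>d e) \<longlongrightarrow> E \<bullet>\<^sub>d f) G"
    using bounded_filter_weak_star_cluster[OF F] by metis
  have limit: "E \<bullet>\<^sub>d f = z" if "((\<lambda>e. f \<bullet>\<^sub>d e) \<longlongrightarrow> z) G" for f z
    using tendsto_unique[OF G(2) lim that] .
  have "E \<bullet>\<^sub>d (f \<lhd> a) = f \<bullet>\<^sub>d a" for f a
    by (rule limit) (simp add: tendsto_cdual_apply tendsto_mono[OF G(1) right])
  then have act: "functional_act (cdual_apply E) f = f" for f
    by (auto intro!: cdual_eqI)
  show thesis
  proof (rule that[OF E])
    show "\<Phi> \<box> E = \<Phi>" for \<Phi>
      by (auto intro!: cdual_eqI simp: arens1_apply act)
    have "E \<bullet>\<^sub>d (a \<rhd> f) = f \<bullet>\<^sub>d a" for f a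
      by (rule limit) (simp add: tendsto_cdual_apply tendsto_mono[OF G(1) left])
    then show "E \<box> bidual_embed a = bidual_embed a" for a
      by (auto intro!: cdual_eqI simp: arens1_bidual_embed_apply)
  next
    fix \<Phi> :: "'a cdual cdual"
    assume "\<And>a. bidual_embed a \<box> \<Phi> = 0"
    then have "\<Phi> \<bullet>\<^sub>d (f \<lhd> a) = 0" for f a
      by (metis bidual_embed_arens1_apply cdual_apply_simps(4))
    then have "functional_act (cdual_apply \<Phi>) f = 0" for f
      by (auto intro!: cdual_eqI)
    moreover have "E \<bullet>\<^sub>d 0 = 0" by (rule limit) simp
    ultimately show "E \<box> \<Phi> = 0"
      by (auto intro!: cdual_eqI simp: arens1_apply)
  qed
qed

context algebra_with_involution
begin

text \<open>The two Arens products agree when one factor lies in the algebra, so there \<open>\<theta>\<^sup>*\<^sup>*\<close> reverses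
  the product. This is how the involution makes \<open>A\<close> a two-sided ideal of the bidual if it is a right
  ideal.\<close>

lemma biadj_arens1_embed: "biadj (\<Phi> \<box> bidual_embed a) = bidual_embed (\<theta> a) \<box> biadj \<Phi>"
  by (auto intro!: cdual_eqI simp: arens1_bidual_embed_apply bidual_embed_arens1_apply adj_dual_act)

text \<open>Put \<open>\<tau> \<Phi> = E \<box> \<theta>\<^sup>*\<^sup>* \<Phi>\<close> for a mixed unit \<open>E\<close>. Elements of \<open>E \<box> A\<^sup>*\<^sup>*\<close> are determined by
  their products with the algebra, which remain in the algebra: they act as double multipliers.
  There \<open>\<tau>\<close> is the usual involution of multipliers, \<open>a (\<tau> \<Phi>) = \<theta> (\<Phi> (\<theta> a))\<close> and
  \<open>(\<tau> \<Phi>) a = \<theta> ((\<theta> a) \<Phi>)\<close>, and the identities for \<open>\<tau>\<close> follow by associativity. Its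
  square is multiplication by \<open>E\<close> from the left.\<close>

lemma trivolution_if_right_ideal:
  fixes F :: "'a filter"
  assumes nonzero: "\<exists>a::'a. a \<noteq> 0"
    and F: "bounded_approximate_identity C F"
    and ideal: "right_ideal_in_bidual TYPE('a)"
  shows "\<exists>N (\<tau> :: 'a cdual cdual \<Rightarrow> 'a cdual cdual). equivalent_algebra_norm C (\<box>) N \<and> trivolution N (\<box>) \<tau>"
proof -
  obtain E :: "'a cdual cdual" where E: "norm E \<le> C" and E_right: "\<And>\<Phi>. \<Phi> \<box> E = \<Phi>"
    and E_left: "\<And>a. E \<box> bidual_embed a = bidual_embed a"
    and detect0: "\<And>\<Phi>. (\<And>a. bidual_embed a \<box> \<Phi> = 0) \<Longrightarrow> E \<box> \<Phi> = 0"
    using mixed_unit[OF F] by metis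
  have detect: "\<Phi> = \<Psi>" if "E \<box> \<Phi> = \<Phi>" "E \<box> \<Psi> = \<Psi>"
    "\<And>a. bidual_embed a \<box> \<Phi> = bidual_embed a \<box> \<Psi>" for \<Phi> \<Psi>
    using detect0[of "\<Phi> - \<Psi>"] that by (simp add: arens1_linear_right)
  have right: "\<exists>b. bidual_embed a \<box> \<Phi> = bidual_embed b" for a and \<Phi> :: "'a cdual cdual"
    using ideal by (auto simp: right_ideal_in_bidual_def)
  have left: "\<exists>b. \<Phi> \<box> bidual_embed a = bidual_embed b" for a and \<Phi> :: "'a cdual cdual"
  proof -
    obtain b where "bidual_embed (\<theta> a) \<box> biadj \<Phi> = bidual_embed b" using right by blast
    then have "biadj (biadj (\<Phi> \<box> bidual_embed a)) = bidual_embed (\<theta> b)"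
      by (simp add: biadj_arens1_embed)
    then show ?thesis by auto
  qed
  define \<tau> where "\<tau> \<Phi> = E \<box> biadj \<Phi>" for \<Phi>
  have E_\<tau>: "E \<box> \<tau> \<Phi> = \<tau> \<Phi>" for \<Phi>
    by (simp add: \<tau>_def E_right flip: arens1_assoc)
  have embed_\<tau>: "bidual_embed a \<box> \<tau> \<Phi> = biadj (\<Phi> \<box> bidual_embed (\<theta> a))" for a \<Phi>
    by (simp add: \<tau>_def E_right biadj_arens1_embed flip: arens1_assoc)
  have \<tau>_embed: "\<tau> \<Phi> \<box> bidual_embed a = biadj (bidual_embed (\<theta> a) \<box> \<Phi>)" for a \<Phi>
  proof -
    obtain b where b: "biadj \<Phi> \<box> bidual_embed a = bidual_embed b" using left by blast
    then have "\<tau> \<Phi> \<box> bidual_embed a = biadj \<Phi> \<box> bidual_embed a"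
      by (simp add: \<tau>_def E_left arens1_assoc)
    also have "\<dots> = biadj (biadj (biadj \<Phi> \<box> bidual_embed a))" by simp
    also have "\<dots> = biadj (bidual_embed (\<theta> a) \<box> \<Phi>)" by (simp only: biadj_arens1_embed biadj_biadj)
    finally show ?thesis .
  qed
  have \<tau>\<tau>: "\<tau> (\<tau> \<Phi>) = E \<box> \<Phi>" for \<Phi>
  proof (rule detect)
    show "E \<box> (E \<box> \<Phi>) = E \<box> \<Phi>" by (simp add: E_right flip: arens1_assoc)
    show "bidual_embed a \<box> \<tau> (\<tau> \<Phi>) = bidual_embed a \<box> (E \<box> \<Phi>)" for a
      by (simp add: embed_\<tau> \<tau>_embed E_right flip: arens1_assoc)
  qed (rule E_\<tau>)
  have "\<tau> \<noteq> (\<lambda>\<Phi>. 0)"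
  proof
    assume zero: "\<tau> = (\<lambda>\<Phi>. 0)"
    obtain a :: 'a where "a \<noteq> 0" using nonzero by blast
    moreover have "bidual_embed a = \<tau> (\<tau> (bidual_embed a))" by (simp add: \<tau>\<tau> E_left)
    ultimately show False using zero bidual_embed_nonzero[of a] by simp
  qed
  moreover have "conj_linear \<tau>"
    by (simp add: conj_linear_def \<tau>_def biadj_add biadj_scaleC arens1_linear_right)
  moreover have "antimultiplicative (\<box>) \<tau>"
    unfolding antimultiplicative_def
  proof (intro allI)
    fix \<Phi> \<Psi>
    show "\<tau> (\<Phi> \<box> \<Psi>) = \<tau> \<Psi> \<box> \<tau> \<Phi>"
    proof (rule detect)
      show "E \<box> (\<tau> \<Psi> \<box> \<tau> \<Phi>) = \<tau> \<Psi> \<box> \<tau> \<Phi>" by (simp add: E_\<tau> flip: arens1_assoc)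
      fix a
      obtain b where b: "\<Psi> \<box> bidual_embed (\<theta> a) = bidual_embed b" using left by blast
      have "bidual_embed a \<box> \<tau> (\<Phi> \<box> \<Psi>) = biadj (\<Phi> \<box> bidual_embed b)"
        by (simp add: embed_\<tau> arens1_assoc b)
      also have "\<dots> = bidual_embed (\<theta> b) \<box> \<tau> \<Phi>"
        by (simp add: embed_\<tau>)
      also have "bidual_embed (\<theta> b) = bidual_embed a \<box> \<tau> \<Psi>"
        by (simp add: embed_\<tau> b)
      finally show "bidual_embed a \<box> \<tau> (\<Phi> \<box> \<Psi>) = bidual_embed a \<box> (\<tau> \<Psi> \<box> \<tau> \<Phi>)"
        by (simp add: arens1_assoc)
    qed (rule E_\<tau>)
  qed
  moreover have "\<tau> (\<tau> (\<tau> \<Phi>)) = \<tau> \<Phi>" for \<Phi>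
    by (simp add: \<tau>\<tau>[of "\<tau> \<Phi>"] E_\<tau>)
  moreover have "norm (E \<box> \<Phi>) \<le> C * norm \<Phi>" for \<Phi>
    by (rule order_trans[OF norm_arens1 mult_right_mono[OF E]]) simp
  then have "norm (\<tau> \<Phi>) \<le> C * norm \<Phi>" "norm (\<tau> (\<tau> \<Phi>)) \<le> C * norm \<Phi>" for \<Phi>
    using order_trans[OF _ mult_left_mono[OF norm_biadj_le[of \<Phi>] order_trans[OF norm_ge_zero E]]]
    unfolding \<tau>\<tau> unfolding \<tau>_def by blast+
  ultimately show ?thesis
    using trivolution_up_to_equivalent_norm[of "(\<box>)" \<tau> C] norm_arens1 by blast
qed

end

section \<open>Introverted subspaces\<close>

lemma restrict_to_in_dual_on:
  assumes "complex_subspace X"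
  shows "restrict_to X \<Phi> \<in> dual_on X"
  using assms norm_cdual_apply[of \<Phi>]
  by (auto simp: dual_on_def restrict_to_def complex_subspace_def)

lemma restrict_to_eq_iff: "restrict_to X \<Phi> = restrict_to X \<Psi> \<longleftrightarrow> (\<forall>f\<in>X. \<Phi> \<bullet>\<^sub>d f = \<Psi> \<bullet>\<^sub>d f)"
  by (auto simp: restrict_to_def fun_eq_iff restrict_def)

lemma dual_norm_on_restrict_to_le:
  assumes "complex_subspace X"
  shows "dual_norm_on X (restrict_to X \<Phi>) \<le> norm \<Phi>"
  unfolding dual_norm_on_def
proof (rule cSUP_least)
  show "{x \<in> X. norm x \<le> 1} \<noteq> {}" using assms by (auto simp: complex_subspace_def intro!: exI[of _ 0])
  show "cmod (restrict_to X \<Phi> x) \<le> norm \<Phi>" if "x \<in> {x \<in> X. norm x \<le> 1}" for x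
    using that order_trans[OF norm_cdual_apply[of \<Phi> x] mult_left_mono[of "norm x" 1 "norm \<Phi>"]]
    by (auto simp: restrict_to_def)
qed

context algebra_with_involution
begin

text \<open>Let \<open>p\<close> be the projection onto \<open>Y\<close> along \<open>X\<degree>\<close> and \<open>\<tau> = p \<circ> \<theta>\<^sup>*\<^sup>*\<close>. Elements of \<open>Y\<close> are
  determined by their restriction to \<open>X\<close>, and there \<open>\<tau>\<close> is the adjoint of the restriction of
  \<open>\<theta>\<^sup>*\<close> to \<open>X\<close>, so \<open>\<tau> \<circ> \<tau> = p\<close>. From \<open>\<theta>\<^sup>* (\<lambda> \<cdot> \<tau> \<Psi>) = \<Psi> \<cdot> \<theta>\<^sup>* \<lambda>\<close> one obtains
  \<open>\<tau> (\<Phi> \<box> \<Psi>) = \<tau> \<Psi> \<diamond> \<tau> \<Phi>\<close> on \<open>X\<close>, and there the two Arens products coincide.\<close>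

lemma trivolution_if_introverted_split:
  fixes X :: "'a cdual set"
  assumes intro: "introverted X" and nonzero: "X \<noteq> {0}"
    and arens: "\<And>\<Phi> \<Psi>. \<Phi> \<in> dual_on X \<Longrightarrow> \<Psi> \<in> dual_on X \<Longrightarrow> arens1_on X \<Phi> \<Psi> = arens2_on X \<Phi> \<Psi>"
    and adj_X: "adj ` X \<subseteq> X"
    and split: "bidual_splits X Y"
  shows "\<exists>\<tau> :: 'a cdual cdual \<Rightarrow> 'a cdual cdual. trivolution norm (\<box>) \<tau>"
proof -
  have module: "closed_submodule X" using intro by (simp add: introverted_def)
  have X: "complex_subspace X" and act: "\<And>f a. f \<in> X \<Longrightarrow> a \<rhd> f \<in> X"
    using module by (auto simp: closed_submodule_def)
  have Y: "complex_subspace Y" and Y_mult: "\<And>\<Phi> \<Psi>. \<Phi> \<in> Y \<Longrightarrow> \<Psi> \<in> Y \<Longrightarrow> \<Phi> \<box> \<Psi> \<in> Y"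
    and bij: "bij_betw (restrict_to X) Y (dual_on X)"
    and iso: "\<And>\<Phi>. \<Phi> \<in> Y \<Longrightarrow> dual_norm_on X (restrict_to X \<Phi>) = norm \<Phi>"
    and restrict_mult: "\<And>\<Phi> \<Psi>. \<Phi> \<in> Y \<Longrightarrow> \<Psi> \<in> Y \<Longrightarrow>
      restrict_to X (\<Phi> \<box> \<Psi>) = arens1_on X (restrict_to X \<Phi>) (restrict_to X \<Psi>)"
    using split by (auto simp: bidual_splits_def)
  have dual: "restrict_to X \<Phi> \<in> dual_on X" for \<Phi>
    using restrict_to_in_dual_on[OF X] .
  have Y_eqI: "\<Phi> = \<Psi>" if "\<Phi> \<in> Y" "\<Psi> \<in> Y" "\<And>f. f \<in> X \<Longrightarrow> \<Phi> \<bullet>\<^sub>d f = \<Psi> \<bullet>\<^sub>d f" for \<Phi> \<Psi>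
    using bij_betw_imp_inj_on[OF bij] that by (simp add: inj_on_def restrict_to_eq_iff)
  define p where "p \<Phi> = inv_into Y (restrict_to X) (restrict_to X \<Phi>)" for \<Phi>
  have p_Y: "p \<Phi> \<in> Y" for \<Phi>
    unfolding p_def using bij_betw_imp_surj_on[OF bij] dual by (intro inv_into_into) auto
  have restrict_p: "restrict_to X (p \<Phi>) = restrict_to X \<Phi>" for \<Phi>
    unfolding p_def using bij_betw_imp_surj_on[OF bij] dual by (intro f_inv_into_f) auto
  then have p_apply: "p \<Phi> \<bullet>\<^sub>d f = \<Phi> \<bullet>\<^sub>d f" if "f \<in> X" for \<Phi> f
    using that restrict_to_eq_iff by blast
  have norm_p: "norm (p \<Phi>) \<le> norm \<Phi>" for \<Phi>
    using dual_norm_on_restrict_to_le[OF X, of \<Phi>] iso[OF p_Y, of \<Phi>] by (simp add: restrict_p)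
  define \<tau> where "\<tau> \<Phi> = p (biadj \<Phi>)" for \<Phi>
  have \<tau>_apply: "\<tau> \<Phi> \<bullet>\<^sub>d f = cnj (\<Phi> \<bullet>\<^sub>d adj f)" if "f \<in> X" for \<Phi> f
    using p_apply[OF that] by (simp add: \<tau>_def)
  have \<tau>\<tau>: "\<tau> (\<tau> \<Phi>) = p \<Phi>" for \<Phi>
    by (rule Y_eqI) (use adj_X in \<open>auto simp: p_Y \<tau>_apply p_apply\<close>, simp add: \<tau>_def p_Y)
  have "\<tau> \<noteq> (\<lambda>\<Phi>. 0)"
  proof
    assume zero: "\<tau> = (\<lambda>\<Phi>. 0)"
    obtain f where f: "f \<in> X" "f \<noteq> 0" using nonzero X by (auto simp: complex_subspace_def)
    then obtain a where "f \<bullet>\<^sub>d a \<noteq> 0" using cdual_eqI[of f 0] by auto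
    then have "\<tau> (\<tau> (bidual_embed a)) \<bullet>\<^sub>d f \<noteq> 0" using f(1) by (simp add: \<tau>\<tau> p_apply)
    then show False by (simp add: zero)
  qed
  moreover have "conj_linear \<tau>"
    unfolding conj_linear_def
  proof (intro conjI allI)
    show "\<tau> (\<Phi> + \<Psi>) = \<tau> \<Phi> + \<tau> \<Psi>" for \<Phi> \<Psi>
      by (rule Y_eqI) (use p_Y Y in \<open>auto simp: \<tau>_apply complex_subspace_def\<close>, simp_all add: \<tau>_def p_Y)
    show "\<tau> (c *\<^sub>C \<Phi>) = cnj c *\<^sub>C \<tau> \<Phi>" for c \<Phi>
      by (rule Y_eqI) (use p_Y Y in \<open>auto simp: \<tau>_apply complex_subspace_def\<close>, simp_all add: \<tau>_def p_Y)
  qed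
  moreover have "antimultiplicative (\<box>) \<tau>"
    unfolding antimultiplicative_def
  proof (intro allI, rule Y_eqI)
    fix \<Phi> \<Psi>
    show "\<tau> (\<Phi> \<box> \<Psi>) \<in> Y" "\<tau> \<Psi> \<box> \<tau> \<Phi> \<in> Y" by (simp_all add: \<tau>_def p_Y Y_mult)
    fix f assume f: "f \<in> X"
    define g where "g = act_functional f (restrict_to X (\<tau> \<Psi>))"
    have g_X: "g \<in> X" using intro f dual by (simp add: introverted_def g_def)
    have adj_g: "adj g = functional_act (cdual_apply \<Psi>) (adj f)"
    proof (rule cdual_eqI)
      fix a
      have "g \<bullet>\<^sub>d \<theta> a = \<tau> \<Psi> \<bullet>\<^sub>d (\<theta> a \<rhd> f)"
        unfolding g_def act_functional_apply[OF module dual f]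
        using act[OF f] by (simp add: restrict_to_def)
      then show "adj g \<bullet>\<^sub>d a = functional_act (cdual_apply \<Psi>) (adj f) \<bullet>\<^sub>d a"
        by (simp add: \<tau>_apply act[OF f] adj_act_dual)
    qed
    have "(\<tau> \<Psi> \<box> \<tau> \<Phi>) \<bullet>\<^sub>d f = restrict_to X (\<tau> \<Psi> \<box> \<tau> \<Phi>) f"
      using f by (simp add: restrict_to_def)
    also have "\<dots> = arens2_on X (restrict_to X (\<tau> \<Psi>)) (restrict_to X (\<tau> \<Phi>)) f"
      using p_Y by (simp add: restrict_mult arens dual \<tau>_def)
    also have "\<dots> = \<tau> \<Phi> \<bullet>\<^sub>d g"
      using f g_X by (simp add: arens2_on_def restrict_to_def g_def)
    also have "\<dots> = cnj (\<Phi> \<bullet>\<^sub>d adj g)" using g_X by (rule \<tau>_apply)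
    also have "\<dots> = \<tau> (\<Phi> \<box> \<Psi>) \<bullet>\<^sub>d f"
      using f by (simp add: \<tau>_apply adj_g arens1_apply)
    finally show "\<tau> (\<Phi> \<box> \<Psi>) \<bullet>\<^sub>d f = (\<tau> \<Psi> \<box> \<tau> \<Phi>) \<bullet>\<^sub>d f" ..
  qed
  moreover have "\<tau> (\<tau> (\<tau> \<Phi>)) = \<tau> \<Phi>" for \<Phi>
    unfolding \<tau>\<tau>[of "\<tau> \<Phi>"] by (rule Y_eqI) (simp_all add: p_Y p_apply \<tau>_def)
  moreover have "norm (\<tau> \<Phi>) \<le> 1 * norm \<Phi>" "norm (\<tau> (\<tau> \<Phi>)) \<le> 1 * norm \<Phi>" for \<Phi>
    using order_trans[OF norm_p norm_biadj_le, of \<Phi>] norm_p[of \<Phi>]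
    unfolding \<tau>\<tau> by (simp_all add: \<tau>_def)
  ultimately have "\<exists>N. equivalent_algebra_norm 1 (\<box>) N \<and> trivolution N (\<box>) \<tau>"
    using trivolution_up_to_equivalent_norm[of "(\<box>)" \<tau> 1] norm_arens1 by blast
  then show ?thesis using equivalent_algebra_norm_1 by blast
qed

end


section \<open>Trivolutions on the bidual\<close>

theorem theorem4p1:
  fixes \<theta> :: "'a::complex_banach_algebra \<Rightarrow> 'a"
  assumes nonzero: "\<exists>a::'a. a \<noteq> 0"
    and involution: "involution norm (*) \<theta>"
  shows
    "((\<exists>X Y. introverted (X :: 'a cdual set) \<and> X \<noteq> {0} \<and> faithful X \<and>
         (\<forall>\<Phi>\<in>dual_on X. \<forall>\<Psi>\<in>dual_on X. arens1_on X \<Phi> \<Psi> = arens2_on X \<Phi> \<Psi>) \<and>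
         conj_adjoint \<theta> ` X \<subseteq> X \<and> bidual_splits X Y)
       \<longrightarrow> (\<exists>\<tau> :: 'a cdual cdual \<Rightarrow> 'a cdual cdual. trivolution norm (\<box>) \<tau>)) \<and>
     ((\<exists>J :: 'a \<Rightarrow> 'e::complex_banach cdual. dual_banach_algebra J)
       \<longrightarrow> (\<exists>\<tau> :: 'a cdual cdual \<Rightarrow> 'a cdual cdual. trivolution norm (\<box>) \<tau>)) \<and>
     (\<forall>C. (\<exists>F :: 'a filter. bounded_approximate_identity C F) \<and> right_ideal_in_bidual TYPE('a)
       \<longrightarrow> (\<exists>N (\<tau> :: 'a cdual cdual \<Rightarrow> 'a cdual cdual).
             equivalent_algebra_norm C (\<box>) N \<and> trivolution N (\<box>) \<tau>)) \<and>
     (\<forall>(I :: 'a cdual cdual set) p. bidual_splits_over_ideal I p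
       \<longrightarrow> (\<exists>N (\<tau> :: 'a cdual cdual \<Rightarrow> 'a cdual cdual).
             equivalent_algebra_norm (onorm p) (\<box>) N \<and> trivolution N (\<box>) \<tau>))"
proof -
  interpret algebra_with_involution \<theta>
    using involution by unfold_locales
  show ?thesis
  proof (intro conjI impI allI; (elim exE conjE)?)
    fix X :: "'a cdual set" and Y
    assume "introverted X" "X \<noteq> {0}" "conj_adjoint \<theta> ` X \<subseteq> X" "bidual_splits X Y"
      and "\<forall>\<Phi>\<in>dual_on X. \<forall>\<Psi>\<in>dual_on X. arens1_on X \<Phi> \<Psi> = arens2_on X \<Phi> \<Psi>"
    then show "\<exists>\<tau> :: 'a cdual cdual \<Rightarrow> 'a cdual cdual. trivolution norm (\<box>) \<tau>"
      by (intro trivolution_if_introverted_split[of X Y]) auto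
  next
    fix J :: "'a \<Rightarrow> 'e cdual"
    assume "dual_banach_algebra J"
    then show "\<exists>\<tau> :: 'a cdual cdual \<Rightarrow> 'a cdual cdual. trivolution norm (\<box>) \<tau>"
      by (rule trivolution_if_dual_banach_algebra[OF nonzero])
  next
    fix C and F :: "'a filter"
    assume "right_ideal_in_bidual TYPE('a)" "bounded_approximate_identity C F"
    then show "\<exists>N (\<tau> :: 'a cdual cdual \<Rightarrow> 'a cdual cdual).
        equivalent_algebra_norm C (\<box>) N \<and> trivolution N (\<box>) \<tau>"
      by (intro trivolution_if_right_ideal[OF nonzero])
  next
    fix I :: "'a cdual cdual set" and p
    assume "bidual_splits_over_ideal I p"
    then show "\<exists>N (\<tau> :: 'a cdual cdual \<Rightarrow> 'a cdual cdual).
        equivalent_algebra_norm (onorm p) (\<box>) N \<and> trivolution N (\<box>) \<tau>"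
      by (rule trivolution_if_bidual_splits_over_ideal[OF nonzero])
  qed
qed

end
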